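(* Assume all of the following. (A1) There exist $C_1<\infty$ and $\rho\in(0,1)$ such that for every $n\ge 1$, $\sup_{l\ge 0}\sup_{x\in\mathsf{X}}\|K_l^n(x,\cdot)-\pi_l(\cdot)\|_{\mathrm{tv}}\le C_1\rho^n$. (A2) There exists $C_2<\infty$ such that for every $l\ge 1$, every $\varphi\in\mathscr{B}_b(\mathsf{X})\cap\mathrm{Lip}(\mathsf{X})$ and all $(x,y)\in\mathsf{X}\times\mathsf{X}$, $|K_l(\varphi)(x)-K_l(\varphi)(y)|\le C_2(\|\varphi\|\vee\|\varphi\|_{\mathrm{Lip}})|x-y|$. (A3) There exists $C_3<\infty$ such that for every $l\ge 1$ and every $\varphi\in\mathscr{B}_b(\mathsf{X})$: (1) $|[\pi_l-\pi_{l-1}](\varphi)|\le C_3\|\varphi\|h_l^{\beta}$; (2) $\sup_{x\in\mathsf{X}}|K_l(\varphi)(x)-K_{l-1}(\varphi)(x)|\le C_3\|\varphi\|h_l^{\beta}$. (A4) There exists $\tau\in(0,1)$ such that for every $l\ge 1$ and all $(x,y)\in\mathsf{X}\times\mathsf{X}$, $\int_{\mathsf{U}}|\xi_l(x,u)-\xi_l(y,u)|^2\mu(du)\le\tau|x-y|^2$. (A5) There exists $C_5<\infty$ such that for every $l\ge 1$ and every $x\in\mathsf{X}$, $\int_{\mathsf{U}}|\xi_l(x,u)-\xi_{l-1}(x,u)|^2\mu(du)\le C_5h_l^{\beta}$. Then there exists $C<+\infty$ such that for every $l\ge 1$, every $N_l\ge 1$ and every $\varphi\in\mathscr{B}_b(\mathsf{X})\cap\mathrm{Lip}(\mathsf{X})$,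 $$\mathbb{E}\Big[\Big(\frac{1}{N_l}\sum_{n=1}^{N_l}\big\{[\varphi(\overline{X}_n(l))-\varphi(\underline{X}_n(l))]-[\pi_l-\pi_{l-1}](\varphi)\big\}\Big)^2\Big]\le\frac{C(\|\varphi\|\vee\|\varphi\|_{\mathrm{Lip}})^2h_l^{\beta}}{N_l}.$$
   Context: Setting. $\mathsf{X}$ is a compact subset of a Euclidean space with its Borel $\sigma$-algebra $\mathcal{X}$, and $|\cdot|$ denotes the $L_1$-norm. $(h_l)_{l\ge 0}$ is a strictly decreasing sequence with $1>h_0>h_1>\cdots>0$, and $\beta>0$ is a fixed constant. $(\pi_l)_{l\ge 0}$ is a sequence of probability measures on $(\mathsf{X},\mathcal{X})$, and there is a probability measure $\pi$ on $(\mathsf{X},\mathcal{X})$ with $\lim_{l\to\infty}|\pi_l(\varphi)-\pi(\varphi)|=0$ for every bounded measurable $\varphi:\mathsf{X}\to\mathbb{R}$. Kernels. $(\mathsf{U},\mathcal{U})$ is a (finite-dimensional) measurable space with a probability measure $\mu$. For each $l\ge 0$, $\xi_l:\mathsf{X}\times\mathsf{U}\to\mathsf{X}$ is jointly measurable, and $K_l$ is the Markov kernel on $\mathsf{X}$ with $K_l(x,\cdot)$ the law of $\xi_l(x,U)$, $U\sim\mu$. It is assumed that $\pi_l$ is an invariant measure of $K_l$. Coupled chains. For each $l\ge 1$ a starting point $X_0(l)\in\mathsf{X}$ is given (deterministic), $\overline{X}_0(l)=\underline{X}_0(l)=X_0(l)$, and for $n\ge 1$, $\overline{X}_n(l)=\xi_l(\overline{X}_{n-1}(l),U_n(l))$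 and $\underline{X}_n(l)=\xi_{l-1}(\underline{X}_{n-1}(l),U_n(l))$, where $(U_n(l))_{n\ge1}$ are i.i.d. with law $\mu$ and are common to both recursions. Notation. $\mathscr{B}_b(\mathsf{X})$ and $\mathrm{Lip}(\mathsf{X})$ are the bounded measurable and the Lipschitz functions $\mathsf{X}\to\mathbb{R}$; $\|\varphi\|=\sup_x|\varphi(x)|$; $\|\varphi\|_{\mathrm{Lip}}=\sup_{x\ne y}|\varphi(x)-\varphi(y)|/|x-y|$; $a\vee b=\max(a,b)$; $\nu(\varphi)=\int\varphi\,d\nu$; $[\pi_l-\pi_{l-1}](\varphi)=\pi_l(\varphi)-\pi_{l-1}(\varphi)$; $K(\varphi)(x)=\int\varphi(y)K(x,dy)$; $K^n$ is the $n$-th iterate of $K$; $\|\mu_1-\mu_2\|_{\mathrm{tv}}=\sup_{A\in\mathcal{X}}|\mu_1(A)-\mu_2(A)|$. *)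

theory Defs
  imports "HOL-Probability.Probability"
begin

definition l1_norm :: "'a::euclidean_space \<Rightarrow> real" where
  "l1_norm x = (\<Sum>b\<in>Basis. \<bar>x \<bullet> b\<bar>)"

text \<open>
  Functions on \<open>X\<close> are represented by functions on the whole type; none of the notions
  below depends on their values outside \<open>X\<close>.
\<close>

definition bounded_measurable_on :: "'a::euclidean_space set \<Rightarrow> ('a \<Rightarrow> real) set" where
  "bounded_measurable_on X =
     {\<phi>. \<phi> \<in> borel_measurable (restrict_space borel X) \<and> bounded (\<phi> ` X)}"

text \<open>The Lipschitz property is taken with respect to the \<open>L\<^sub>1\<close>-norm, not the Euclidean one.\<close>

definition l1_Lipschitz_on :: "'a::euclidean_space set \<Rightarrow> ('a \<Rightarrow> real) set" where
  "l1_Lipschitz_on X =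
     {\<phi>. \<exists>L. \<forall>x\<in>X. \<forall>y\<in>X. \<bar>\<phi> x - \<phi> y\<bar> \<le> L * l1_norm (x - y)}"

definition sup_norm_on :: "'a set \<Rightarrow> ('a \<Rightarrow> real) \<Rightarrow> real" where
  "sup_norm_on X \<phi> = (SUP x\<in>X. \<bar>\<phi> x\<bar>)"

text \<open>
  Inserting \<open>0\<close> only matters if \<open>X\<close> has at most one point, where it makes the
  supremum over the empty set equal to \<open>0\<close>.
\<close>

definition Lip_seminorm_on :: "'a::euclidean_space set \<Rightarrow> ('a \<Rightarrow> real) \<Rightarrow> real" where
  "Lip_seminorm_on X \<phi> =
     Sup (insert 0 {\<bar>\<phi> x - \<phi> y\<bar> / l1_norm (x - y) | x y. x \<in> X \<and> y \<in> X \<and> x \<noteq> y})"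

definition max_norm_on :: "'a::euclidean_space set \<Rightarrow> ('a \<Rightarrow> real) \<Rightarrow> real" where
  "max_norm_on X \<phi> = max (sup_norm_on X \<phi>) (Lip_seminorm_on X \<phi>)"

text \<open>Used for probability measures with the same measurable sets only.\<close>

definition tv_dist :: "'a measure \<Rightarrow> 'a measure \<Rightarrow> real" where
  "tv_dist M N = (SUP A\<in>sets M. \<bar>measure M A - measure N A\<bar>)"

definition map_kernel ::
    "'a::euclidean_space set \<Rightarrow> 'u measure \<Rightarrow> ('a \<Rightarrow> 'u \<Rightarrow> 'a) \<Rightarrow> 'a \<Rightarrow> 'a measure" where
  "map_kernel X \<mu> \<xi> x = distr \<mu> (restrict_space borel X) (\<xi> x)"

primrec kernel_iter ::
    "'a::euclidean_space set \<Rightarrow> ('a \<Rightarrow> 'a measure) \<Rightarrow> nat \<Rightarrow> 'a \<Rightarrow> 'a measure" where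
  "kernel_iter X K 0 x = return (restrict_space borel X) x"
| "kernel_iter X K (Suc n) x = kernel_iter X K n x \<bind> K"

definition kernel_apply :: "('a \<Rightarrow> 'a measure) \<Rightarrow> ('a \<Rightarrow> real) \<Rightarrow> 'a \<Rightarrow> real" where
  "kernel_apply K \<phi> x = (\<integral>y. \<phi> y \<partial>K x)"

definition invariant_measure :: "('a \<Rightarrow> 'a measure) \<Rightarrow> 'a measure \<Rightarrow> bool" where
  "invariant_measure K \<nu> \<longleftrightarrow> \<nu> \<bind> K = \<nu>"

text \<open>The innovations are indexed from \<open>1\<close>; \<open>V 0\<close> is not used.\<close>

primrec chain ::
    "('a \<Rightarrow> 'u \<Rightarrow> 'a) \<Rightarrow> 'a \<Rightarrow> (nat \<Rightarrow> 'w \<Rightarrow> 'u) \<Rightarrow> nat \<Rightarrow> 'w \<Rightarrow> 'a" where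
  "chain \<xi> x V 0 \<omega> = x"
| "chain \<xi> x V (Suc n) \<omega> = \<xi> (chain \<xi> x V n \<omega>) (V (Suc n) \<omega>)"

end

theory Submission
  imports Defs
begin

text \<open>
  Fix a level \<open>l\<close> and let \<open>D n\<close> be the \<open>n\<close>-th centred summand. The second moment of a sum of
  \<open>N\<close> terms is of order \<open>N\<close> as soon as the correlations \<open>E (D i * D (i + m))\<close> decay
  geometrically in \<open>m\<close> (\<open>second_moment_sum_le\<close>), so it is enough to bound them by a multiple of
  \<open>M\<^sup>2 * r ^ m * h l powr \<beta>\<close>, where \<open>M\<close> is the larger of the two norms of \<open>\<phi>\<close> and \<open>r < 1\<close>.

  By the Markov property (\<open>expectation_chain_add\<close>), \<open>D (i + m)\<close> may be replaced in the
  correlation by its conditional mean given the pair \<open>(a, b)\<close> of chains at time \<open>i\<close>. Writing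
  \<open>T\<close> and \<open>T'\<close> for the Markov operators of levels \<open>l\<close> and \<open>l - 1\<close>, this mean is the sum of
  \<open>(T ^^ m) \<phi> a - (T ^^ m) \<phi> b\<close> and the difference of \<open>(T ^^ m) \<phi> b - \<pi> l \<phi>\<close> and
  \<open>(T' ^^ m) \<phi> b - \<pi> (l - 1) \<phi>\<close>.

  The first part is at most \<open>M * sqrt \<tau> ^ m\<close> times the distance of \<open>a\<close> and \<open>b\<close>, because the
  random map of level \<open>l\<close> contracts in mean square (\<open>T_pow_Lipschitz\<close>); and the mean square of
  that distance is of order \<open>h l powr \<beta>\<close> uniformly in time, because the contraction absorbs
  the discrepancy of the two maps that each step adds (\<open>expectation_coupled_distance_le\<close>).

  The second part has two bounds. Uniform ergodicity gives one of order \<open>M * \<rho> ^ m\<close>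
  (\<open>markov_op_pow_mixing\<close>). Replacing one kernel at a time, and using ergodicity again to sum the
  errors, gives one of order \<open>M * h l powr \<beta>\<close> that is uniform in \<open>m\<close>
  (\<open>markov_op_pow_diff_le\<close>). Their geometric mean \<open>M * sqrt (\<rho> ^ m * h l powr \<beta>)\<close> is what is
  needed: together with the factor \<open>D i\<close>, which is the case \<open>m = 0\<close> of the same estimates, it
  produces the rate \<open>h l powr \<beta>\<close> and keeps the geometric decay
  (\<open>expectation_coupled_average_le\<close>).
\<close>

section \<open>Total variation and integrals of bounded functions\<close>

lemma integrable_bounded:
  fixes f :: "'a \<Rightarrow> real"
  assumes "finite_measure M" "f \<in> borel_measurable M" "\<And>x. x \<in> space M \<Longrightarrow> \<bar>f x\<bar> \<le> B"
  shows "integrable M f"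
  using assms by (intro finite_measure.integrable_const_bound[where B=B]) auto

lemma abs_integral_le_bound:
  fixes f :: "'a \<Rightarrow> real"
  assumes "prob_space M" "f \<in> borel_measurable M" "\<And>x. x \<in> space M \<Longrightarrow> \<bar>f x\<bar> \<le> B"
  shows "\<bar>\<integral>x. f x \<partial>M\<bar> \<le> B"
proof -
  interpret prob_space M by fact
  have "integrable M f" by (rule integrable_bounded[OF finite_measure_axioms assms(2,3)])
  have "\<bar>\<integral>x. f x \<partial>M\<bar> \<le> (\<integral>x. \<bar>f x\<bar> \<partial>M)" by (rule integral_abs_bound)
  also have "\<dots> \<le> (\<integral>x. B \<partial>M)"
    using \<open>integrable M f\<close> assms(3) by (intro integral_mono) auto
  finally show ?thesis by (simp add: prob_space)
qed

lemma abs_measure_diff_le_tv_dist: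
  assumes "prob_space M" "prob_space N" "sets M = sets N" "A \<in> sets M"
  shows "\<bar>measure M A - measure N A\<bar> \<le> tv_dist M N"
  unfolding tv_dist_def
proof (rule cSUP_upper)
  show "bdd_above ((\<lambda>A. \<bar>measure M A - measure N A\<bar>) ` sets M)"
  proof (rule bdd_aboveI2)
    fix A
    show "\<bar>measure M A - measure N A\<bar> \<le> 1"
      using prob_space.prob_le_1[OF assms(1), of A] prob_space.prob_le_1[OF assms(2), of A]
        measure_nonneg[of M A] measure_nonneg[of N A] by linarith
  qed
qed (fact assms)

text \<open>
  A function \<open>g\<close> with values in \<open>[0, 1]\<close> is within \<open>1 / n\<close> of the average of the indicators
  of its superlevel sets at \<open>1 / n, \<dots>, n / n\<close>, and the integral of each indicator changes by
  at most the total variation distance.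
\<close>

lemma abs_integral_diff_le_tv_dist_unit:
  fixes g :: "'a \<Rightarrow> real"
  assumes M: "prob_space M" and N: "prob_space N" and sets: "sets M = sets N"
    and g: "g \<in> borel_measurable M" and range: "\<And>x. x \<in> space M \<Longrightarrow> 0 \<le> g x \<and> g x \<le> 1"
  shows "\<bar>(\<integral>x. g x \<partial>M) - (\<integral>x. g x \<partial>N)\<bar> \<le> tv_dist M N"
proof (rule field_le_epsilon)
  fix e :: real assume "0 < e"
  obtain n :: nat where "2 / e < real n" using reals_Archimedean2 by blast
  moreover have "0 < 2 / e" using \<open>0 < e\<close> by simp
  ultimately have "0 < real n" by linarith
  then have n: "0 < n" "2 / real n < e"
    using \<open>2 / e < real n\<close> \<open>0 < e\<close> by (auto simp: field_simps)
  define A where "A k = {x \<in> space M. real k \<le> real n * g x}" for k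
  define s where "s x = (\<Sum>k=1..n. indicator (A k) x / real n :: real)" for x
  have A[measurable]: "A k \<in> sets M" for k
    using g unfolding A_def by measurable
  have s_meas: "s \<in> borel_measurable M" unfolding s_def by measurable
  have s: "\<bar>g x - s x\<bar> \<le> 1 / real n" if x: "x \<in> space M" for x
  proof -
    have ng: "0 \<le> real n * g x" "real n * g x \<le> real n"
      using range[OF x] n by (auto simp: mult_left_le)
    define m where "m = nat \<lfloor>real n * g x\<rfloor>"
    have m: "\<lfloor>real n * g x\<rfloor> = int m" using ng(1) by (simp add: m_def)
    then have le_m: "real k \<le> real n * g x \<longleftrightarrow> k \<le> m" for k
      by (metis le_floor_iff of_int_of_nat_eq of_nat_le_iff)
    have "real m \<le> real n"
      using le_m[of m] ng(2) by (meson order.refl order.trans)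
    then have "m \<le> n" by simp
    then have "{1..n} \<inter> {k. real k \<le> real n * g x} = {1..m}" by (auto simp: le_m)
    moreover have "(\<Sum>k=1..n. indicator (A k) x :: real)
        = (\<Sum>k\<in>{1..n} \<inter> {k. real k \<le> real n * g x}. 1)"
      unfolding sum.inter_restrict[OF finite_atLeastAtMost] using x
      by (intro sum.cong) (auto simp: A_def indicator_def)
    ultimately have "(\<Sum>k=1..n. indicator (A k) x :: real) = of_int \<lfloor>real n * g x\<rfloor>"
      using m by simp
    then have "s x = of_int \<lfloor>real n * g x\<rfloor> / real n"
      by (simp add: s_def sum_divide_distrib[symmetric])
    moreover have "g x = (real n * g x) / real n" using n by simp
    ultimately have "g x - s x = (real n * g x - of_int \<lfloor>real n * g x\<rfloor>) / real n"
      by (metis diff_divide_distrib)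
    moreover have "0 \<le> real n * g x - of_int \<lfloor>real n * g x\<rfloor>"
      "real n * g x - of_int \<lfloor>real n * g x\<rfloor> \<le> 1" by linarith+
    ultimately show ?thesis using n by (simp add: divide_right_mono)
  qed
  have close: "\<bar>(\<integral>x. g x \<partial>L) - (\<integral>x. s x \<partial>L)\<bar> \<le> 1 / real n"
    if L: "prob_space L" "sets L = sets M" for L
  proof -
    interpret L: prob_space L by fact
    have gL[measurable]: "g \<in> borel_measurable L" and sL[measurable]: "s \<in> borel_measurable L"
      using g s_meas measurable_cong_sets[OF L(2) refl] by auto
    have spL: "space L = space M" using sets_eq_imp_space_eq[OF L(2)] by simp
    have s_bound: "\<bar>s x\<bar> \<le> 1 + 1 / real n" if "x \<in> space L" for x
      using s[of x] range[of x] that spL by (simp add: abs_le_iff)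
    have "integrable L g" by (rule integrable_bounded[where B=1]) (use range spL L.finite_measure_axioms in auto)
    moreover have "integrable L s"
      by (rule integrable_bounded[OF L.finite_measure_axioms sL s_bound])
    ultimately have "(\<integral>x. g x \<partial>L) - (\<integral>x. s x \<partial>L) = (\<integral>x. g x - s x \<partial>L)" by simp
    also have "\<bar>\<dots>\<bar> \<le> 1 / real n"
      by (rule abs_integral_le_bound) (use s spL L in auto)
    finally show ?thesis .
  qed
  have s_int: "(\<integral>x. s x \<partial>L) = (\<Sum>k=1..n. measure L (A k) / real n)"
    if L: "prob_space L" "sets L = sets M" for L
  proof -
    interpret L: prob_space L by fact
    have "A k \<in> sets L" for k using A L by simp
    moreover have "A k \<inter> space L = A k" for k
      using sets_eq_imp_space_eq[OF L(2)] by (auto simp: A_def)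
    ultimately show ?thesis unfolding s_def
      by (subst Bochner_Integration.integral_sum) (auto simp: less_top[symmetric])
  qed
  have "\<bar>(\<integral>x. s x \<partial>M) - (\<integral>x. s x \<partial>N)\<bar>
      = \<bar>\<Sum>k=1..n. (measure M (A k) - measure N (A k)) / real n\<bar>"
    using s_int[OF M] s_int[OF N] sets by (simp add: sum_subtractf diff_divide_distrib)
  also have "\<dots> \<le> (\<Sum>k=1..n. \<bar>(measure M (A k) - measure N (A k)) / real n\<bar>)"
    by (rule sum_abs)
  also have "\<dots> \<le> (\<Sum>k=1..n. tv_dist M N / real n)"
    using abs_measure_diff_le_tv_dist[OF M N sets A] n
    by (intro sum_mono) (simp add: divide_right_mono)
  also have "\<dots> = tv_dist M N" using n by simp
  finally have "\<bar>(\<integral>x. s x \<partial>M) - (\<integral>x. s x \<partial>N)\<bar> \<le> tv_dist M N" .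
  moreover have "1 / real n + 1 / real n < e" using n by simp
  ultimately show "\<bar>(\<integral>x. g x \<partial>M) - (\<integral>x. g x \<partial>N)\<bar> \<le> tv_dist M N + e"
    using close[OF M refl] close[OF N sets[symmetric]] by linarith
qed

lemma abs_integral_diff_le_tv_dist:
  fixes f :: "'a \<Rightarrow> real"
  assumes M: "prob_space M" and N: "prob_space N" and sets: "sets M = sets N"
    and f: "f \<in> borel_measurable M" and bound: "\<And>x. x \<in> space M \<Longrightarrow> \<bar>f x\<bar> \<le> B"
  shows "\<bar>(\<integral>x. f x \<partial>M) - (\<integral>x. f x \<partial>N)\<bar> \<le> 2 * B * tv_dist M N"
proof (cases "0 < B")
  case False
  have space: "space N = space M" using sets_eq_imp_space_eq[OF sets] by simp
  have "f \<in> borel_measurable N" using f measurable_cong_sets[OF sets refl] by auto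
  then have "\<bar>\<integral>x. f x \<partial>M\<bar> \<le> B" "\<bar>\<integral>x. f x \<partial>N\<bar> \<le> B"
    using bound space by (auto intro!: abs_integral_le_bound M N f)
  with False have "B = 0" "(\<integral>x. f x \<partial>M) = 0" "(\<integral>x. f x \<partial>N) = 0" by linarith+
  then show ?thesis by simp
next
  case B: True
  define g where "g x = (f x + B) / (2 * B)" for x
  have g: "g \<in> borel_measurable M" using f unfolding g_def by measurable
  have range: "0 \<le> g x \<and> g x \<le> 1" if "x \<in> space M" for x
    using bound[OF that] B by (auto simp: g_def field_simps abs_le_iff)
  have int: "(\<integral>x. f x \<partial>L) = 2 * B * (\<integral>x. g x \<partial>L) - B"
    if L: "prob_space L" "sets L = sets M" for L
  proof -
    interpret L: prob_space L by fact
    have "g \<in> borel_measurable L" using g measurable_cong_sets[OF L(2) refl] by auto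
    then have "integrable L g"
      using range sets_eq_imp_space_eq[OF L(2)]
      by (intro integrable_bounded[where B=1] L.finite_measure_axioms) auto
    then have "(\<integral>x. 2 * B * g x - B \<partial>L) = 2 * B * (\<integral>x. g x \<partial>L) - B"
      by (simp add: L.prob_space)
    moreover have "f = (\<lambda>x. 2 * B * g x - B)" using B by (auto simp: g_def field_simps)
    ultimately show ?thesis by simp
  qed
  have "(\<integral>x. f x \<partial>M) - (\<integral>x. f x \<partial>N) = 2 * B * ((\<integral>x. g x \<partial>M) - (\<integral>x. g x \<partial>N))"
    using int[OF M refl] int[OF N sets[symmetric]] by (simp add: algebra_simps)
  then show ?thesis
    using abs_integral_diff_le_tv_dist_unit[OF M N sets g range] B
    by (simp add: abs_mult)
qed

lemma square_integral_le:
  fixes f :: "'a \<Rightarrow> real"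
  assumes "prob_space M" "f \<in> borel_measurable M" "\<And>x. x \<in> space M \<Longrightarrow> \<bar>f x\<bar> \<le> B"
  shows "(\<integral>x. f x \<partial>M)\<^sup>2 \<le> (\<integral>x. (f x)\<^sup>2 \<partial>M)"
proof -
  interpret prob_space M by fact
  have f: "integrable M f" by (rule integrable_bounded[OF finite_measure_axioms assms(2,3)])
  have "(f x)\<^sup>2 \<le> B\<^sup>2" if "x \<in> space M" for x
    using assms(3)[OF that] abs_le_square_iff[of "f x" B] by simp
  then have "integrable M (\<lambda>x. (f x)\<^sup>2)"
    using assms(2) by (intro integrable_bounded[where B="B\<^sup>2"] finite_measure_axioms) auto
  then show ?thesis using variance_eq[OF f] variance_positive[of f] by simp
qed

section \<open>Markov operators of random maps\<close>

definition markov_op :: "'u measure \<Rightarrow> ('a \<Rightarrow> 'u \<Rightarrow> 'a) \<Rightarrow> ('a \<Rightarrow> real) \<Rightarrow> 'a \<Rightarrow> real" where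
  "markov_op \<mu> \<xi> \<phi> x = (\<integral>u. \<phi> (\<xi> x u) \<partial>\<mu>)"

locale random_map =
  fixes S :: "'a measure" and \<mu> :: "'u measure" and \<xi> :: "'a \<Rightarrow> 'u \<Rightarrow> 'a"
  assumes prob_innovation: "prob_space \<mu>"
    and measurable_map: "(\<lambda>(x, u). \<xi> x u) \<in> S \<Otimes>\<^sub>M \<mu> \<rightarrow>\<^sub>M S"
begin

sublocale \<mu>: prob_space \<mu> by (rule prob_innovation)

abbreviation T :: "('a \<Rightarrow> real) \<Rightarrow> 'a \<Rightarrow> real" where
  "T \<equiv> markov_op \<mu> \<xi>"

lemma map_in: "x \<in> space S \<Longrightarrow> u \<in> space \<mu> \<Longrightarrow> \<xi> x u \<in> space S"
  using measurable_space[OF measurable_map, of "(x, u)"] by (simp add: space_pair_measure)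

lemma measurable_map_at: "x \<in> space S \<Longrightarrow> \<xi> x \<in> \<mu> \<rightarrow>\<^sub>M S"
  using measurable_compose_Pair1[OF _ measurable_map, of x] by simp

lemma measurable_T:
  assumes [measurable]: "\<phi> \<in> borel_measurable S"
  shows "T \<phi> \<in> borel_measurable S"
proof -
  note measurable_map[measurable]
  show ?thesis
    unfolding markov_op_def by (rule \<mu>.borel_measurable_lebesgue_integral) measurable
qed

lemma abs_T_le:
  assumes "\<phi> \<in> borel_measurable S" "\<And>x. x \<in> space S \<Longrightarrow> \<bar>\<phi> x\<bar> \<le> B" "x \<in> space S"
  shows "\<bar>T \<phi> x\<bar> \<le> B"
  unfolding markov_op_def
  using assms map_in measurable_map_at
  by (intro abs_integral_le_bound prob_innovation) (auto intro: measurable_compose)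

lemma integrable_step:
  fixes \<phi> :: "'a \<Rightarrow> real"
  assumes "\<phi> \<in> borel_measurable S" "\<And>x. x \<in> space S \<Longrightarrow> \<bar>\<phi> x\<bar> \<le> B" "x \<in> space S"
  shows "integrable \<mu> (\<lambda>u. \<phi> (\<xi> x u))"
  using assms map_in measurable_map_at
  by (intro integrable_bounded[where B=B] \<mu>.finite_measure_axioms) (auto intro: measurable_compose)

lemma T_diff:
  assumes "\<phi> \<in> borel_measurable S" "\<And>x. x \<in> space S \<Longrightarrow> \<bar>\<phi> x\<bar> \<le> B"
    and "\<psi> \<in> borel_measurable S" "\<And>x. x \<in> space S \<Longrightarrow> \<bar>\<psi> x\<bar> \<le> B'" and "x \<in> space S"
  shows "T (\<lambda>y. \<phi> y - \<psi> y) x = T \<phi> x - T \<psi> x"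
  unfolding markov_op_def
  using integrable_step[OF assms(1,2,5)] integrable_step[OF assms(3,4,5)] by simp

lemma T_const: "T (\<lambda>_. c) x = c"
  by (simp add: markov_op_def \<mu>.prob_space)

lemma measurable_T_pow: "\<phi> \<in> borel_measurable S \<Longrightarrow> (T ^^ n) \<phi> \<in> borel_measurable S"
  by (induction n) (auto intro: measurable_T)

lemma abs_T_pow_le:
  assumes "\<phi> \<in> borel_measurable S" "\<And>x. x \<in> space S \<Longrightarrow> \<bar>\<phi> x\<bar> \<le> B" "x \<in> space S"
  shows "\<bar>(T ^^ n) \<phi> x\<bar> \<le> B"
  using assms(3) by (induction n arbitrary: x) (auto intro!: assms abs_T_le measurable_T_pow)

text \<open>
  By the Cauchy--Schwarz inequality, a map that contracts squared distances by the factor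
  \<open>\<tau>\<close> on average contracts distances by the factor \<open>sqrt \<tau>\<close> on average, so its Markov
  operator contracts Lipschitz constants by that factor.
\<close>

lemma T_pow_Lipschitz:
  assumes d_meas: "(\<lambda>(x, y). d x y) \<in> borel_measurable (S \<Otimes>\<^sub>M S)"
    and d_range: "\<And>x y. x \<in> space S \<Longrightarrow> y \<in> space S \<Longrightarrow> 0 \<le> d x y \<and> d x y \<le> D"
    and contr: "\<And>x y. x \<in> space S \<Longrightarrow> y \<in> space S \<Longrightarrow>
        (\<integral>u. (d (\<xi> x u) (\<xi> y u))\<^sup>2 \<partial>\<mu>) \<le> \<tau> * (d x y)\<^sup>2"
    and tau: "0 \<le> \<tau>"
    and phi: "\<phi> \<in> borel_measurable S" "\<And>x. x \<in> space S \<Longrightarrow> \<bar>\<phi> x\<bar> \<le> B"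
    and Lip: "\<And>x y. x \<in> space S \<Longrightarrow> y \<in> space S \<Longrightarrow> \<bar>\<phi> x - \<phi> y\<bar> \<le> L * d x y" and L: "0 \<le> L"
    and xy: "x \<in> space S" "y \<in> space S"
  shows "\<bar>(T ^^ n) \<phi> x - (T ^^ n) \<phi> y\<bar> \<le> L * sqrt \<tau> ^ n * d x y"
  using xy
proof (induction n arbitrary: x y)
  case 0
  then show ?case using Lip by simp
next
  case (Suc n)
  let ?f = "(T ^^ n) \<phi>" and ?L = "L * sqrt \<tau> ^ n"
  let ?d = "\<lambda>u. d (\<xi> x u) (\<xi> y u)"
  have L': "0 \<le> ?L" using L tau by simp
  have f: "?f \<in> borel_measurable S" "\<bar>?f z\<bar> \<le> B" if "z \<in> space S" for z
    using phi measurable_T_pow abs_T_pow_le that by blast+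
  have d[measurable]: "?d \<in> borel_measurable \<mu>"
    using measurable_map_at[OF Suc.prems(1)] measurable_map_at[OF Suc.prems(2)] d_meas by measurable
  have d_bound: "0 \<le> ?d u \<and> ?d u \<le> D" if "u \<in> space \<mu>" for u
    using d_range map_in Suc.prems that by blast
  have int_f: "integrable \<mu> (\<lambda>u. ?f (\<xi> z u))" if "z \<in> space S" for z
    using f that by (intro integrable_step[where B=B]) auto
  have int_d: "integrable \<mu> ?d"
    using d_bound by (intro integrable_bounded[where B=D] \<mu>.finite_measure_axioms d) auto
  have "(\<integral>u. ?d u \<partial>\<mu>)\<^sup>2 \<le> (\<integral>u. (?d u)\<^sup>2 \<partial>\<mu>)"
    using d_bound by (intro square_integral_le[where B=D] prob_innovation d) auto
  also have "\<dots> \<le> (sqrt \<tau> * d x y)\<^sup>2"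
    using contr[OF Suc.prems] tau by (simp add: power_mult_distrib)
  finally have Ed: "(\<integral>u. ?d u \<partial>\<mu>) \<le> sqrt \<tau> * d x y"
    by (rule power2_le_imp_le) (use tau d_range[OF Suc.prems] in simp)
  have "\<bar>(T ^^ Suc n) \<phi> x - (T ^^ Suc n) \<phi> y\<bar> = \<bar>\<integral>u. ?f (\<xi> x u) - ?f (\<xi> y u) \<partial>\<mu>\<bar>"
    using int_f Suc.prems by (simp add: markov_op_def)
  also have "\<dots> \<le> (\<integral>u. \<bar>?f (\<xi> x u) - ?f (\<xi> y u)\<bar> \<partial>\<mu>)" by (rule integral_abs_bound)
  also have "\<dots> \<le> (\<integral>u. ?L * ?d u \<partial>\<mu>)"
    using int_f Suc.prems int_d Suc.IH map_in by (intro integral_mono) auto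
  also have "\<dots> = ?L * (\<integral>u. ?d u \<partial>\<mu>)" by simp
  also have "\<dots> \<le> ?L * (sqrt \<tau> * d x y)" using Ed L' by (rule mult_left_mono)
  finally show ?case by (simp add: mult_ac)
qed

end

lemma kernel_apply_map_kernel:
  assumes "random_map (restrict_space borel X) \<mu> \<xi>"
    and "\<phi> \<in> borel_measurable (restrict_space borel X)" and "x \<in> X"
  shows "kernel_apply (map_kernel X \<mu> \<xi>) \<phi> x = markov_op \<mu> \<xi> \<phi> x"
proof -
  interpret random_map "restrict_space borel X" \<mu> \<xi> by fact
  have "x \<in> space (restrict_space borel X)" using assms(3) by (simp add: space_restrict_space)
  from measurable_map_at[OF this] show ?thesis
    using assms(2) by (simp add: kernel_apply_def map_kernel_def markov_op_def integral_distr)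
qed

lemma measurable_map_kernel:
  assumes "random_map (restrict_space borel X) \<mu> \<xi>"
  shows "map_kernel X \<mu> \<xi> \<in> restrict_space borel X \<rightarrow>\<^sub>M subprob_algebra (restrict_space borel X)"
proof -
  interpret random_map "restrict_space borel X" \<mu> \<xi> by fact
  have "(\<lambda>x. distr \<mu> (restrict_space borel X) (\<xi> x))
      \<in> restrict_space borel X \<rightarrow>\<^sub>M subprob_algebra (restrict_space borel X)"
    by (rule measurable_distr2[OF measurable_map]) (simp add: \<mu>.M_in_subprob)
  then show ?thesis by (simp add: map_kernel_def[abs_def])
qed

lemma kernel_iter_eq_markov_op:
  assumes rm: "random_map (restrict_space borel X) \<mu> \<xi>" and x: "x \<in> X"
  defines "\<kappa> \<equiv> \<lambda>n. kernel_iter X (map_kernel X \<mu> \<xi>) n x"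
  shows prob_space_kernel_iter: "prob_space (\<kappa> n)"
    and sets_kernel_iter: "sets (\<kappa> n) = sets (restrict_space borel X)"
    and integral_kernel_iter: "\<And>\<phi> B. \<phi> \<in> borel_measurable (restrict_space borel X) \<Longrightarrow>
        (\<And>y. y \<in> X \<Longrightarrow> \<bar>\<phi> y\<bar> \<le> B) \<Longrightarrow> (\<integral>y. \<phi> y \<partial>\<kappa> n) = (markov_op \<mu> \<xi> ^^ n) \<phi> x"
proof -
  let ?S = "restrict_space borel X" and ?K = "map_kernel X \<mu> \<xi>"
  interpret random_map ?S \<mu> \<xi> by fact
  have space_S: "space ?S = X" by (simp add: space_restrict_space)
  have K: "?K \<in> ?S \<rightarrow>\<^sub>M subprob_algebra ?S" by (rule measurable_map_kernel[OF rm])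
  have prob_K: "prob_space (?K y)" if "y \<in> X" for y
    using that measurable_map_at[of y] unfolding map_kernel_def space_S
    by (intro \<mu>.prob_space_distr) auto
  have "prob_space (\<kappa> n) \<and> sets (\<kappa> n) = sets ?S \<and> (\<forall>\<phi> B. \<phi> \<in> borel_measurable ?S \<longrightarrow>
      (\<forall>y\<in>X. \<bar>\<phi> y\<bar> \<le> B) \<longrightarrow> (\<integral>y. \<phi> y \<partial>\<kappa> n) = (T ^^ n) \<phi> x)"
  proof (induction n)
    case 0
    then show ?case using x space_S
      by (auto simp: \<kappa>_def intro!: prob_space_return integral_return)
  next
    case (Suc n)
    then interpret \<kappa>: prob_space "\<kappa> n" by simp
    have sets: "sets (\<kappa> n) = sets ?S" using Suc by simp
    have space: "space (\<kappa> n) = X" using sets_eq_imp_space_eq[OF sets] space_S by simp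
    have K': "?K \<in> \<kappa> n \<rightarrow>\<^sub>M subprob_algebra ?S"
      using K by (simp add: measurable_cong_sets[OF sets refl])
    have eq: "\<kappa> (Suc n) = \<kappa> n \<bind> ?K" by (simp add: \<kappa>_def)
    have "prob_space (\<kappa> (Suc n))"
      unfolding eq using prob_K space by (intro \<kappa>.prob_space_bind[OF _ K']) (auto intro!: AE_I2)
    moreover have "sets (\<kappa> (Suc n)) = sets ?S"
      unfolding eq using x space K' by (intro sets_bind) (auto dest: sets_kernel)
    moreover have "(\<integral>y. \<phi> y \<partial>\<kappa> (Suc n)) = (T ^^ Suc n) \<phi> x"
      if phi: "\<phi> \<in> borel_measurable ?S" "\<forall>y\<in>X. \<bar>\<phi> y\<bar> \<le> B" for \<phi> B
    proof -
      have "(\<integral>y. \<phi> y \<partial>\<kappa> (Suc n)) = (\<integral>y. (\<integral>z. \<phi> z \<partial>?K y) \<partial>\<kappa> n)"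
        unfolding eq
      proof (rule integral_bind[where K="?S" and B=B and B'=1])
        show "AE y in \<kappa> n. emeasure (?K y) (space (?K y)) \<le> ennreal 1"
          using prob_K space by (intro AE_I2) (simp add: prob_space.emeasure_space_1)
      qed (use phi K' \<kappa>.finite_measure_axioms space_S in auto)
      also have "\<dots> = (\<integral>y. T \<phi> y \<partial>\<kappa> n)"
        using kernel_apply_map_kernel[OF rm phi(1)] space
        by (intro Bochner_Integration.integral_cong) (auto simp: kernel_apply_def)
      also have "\<dots> = (T ^^ n) (T \<phi>) x"
      proof -
        have "\<forall>y\<in>X. \<bar>T \<phi> y\<bar> \<le> B" using abs_T_le[OF phi(1)] phi(2) space_S by auto
        with Suc measurable_T[OF phi(1)] show ?thesis by blast
      qed
      finally show ?thesis by (simp add: funpow_swap1)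
    qed
    ultimately show ?case by blast
  qed
  then show "prob_space (\<kappa> n)" "sets (\<kappa> n) = sets ?S"
    "\<And>\<phi> B. \<phi> \<in> borel_measurable ?S \<Longrightarrow> (\<And>y. y \<in> X \<Longrightarrow> \<bar>\<phi> y\<bar> \<le> B) \<Longrightarrow>
      (\<integral>y. \<phi> y \<partial>\<kappa> n) = (T ^^ n) \<phi> x" by blast+
qed

text \<open>
  The applications of \<open>f\<close> are exchanged for applications of \<open>g\<close> one at a time. The exchange
  made after \<open>j\<close> applications of \<open>g\<close> costs the difference of the two operators at the
  function \<open>(markov_op \<mu> g ^^ j) \<phi>\<close>. Both operators fix constants, so \<open>c\<close> may be subtracted
  from this function first; by the mixing of \<open>g\<close> the costs are then summable, and the bound
  does not grow with \<open>n\<close>.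
\<close>

lemma markov_op_pow_diff_le:
  assumes f: "random_map S \<mu> f" and g: "random_map S \<mu> g"
    and phi: "\<phi> \<in> borel_measurable S" "\<And>x. x \<in> space S \<Longrightarrow> \<bar>\<phi> x\<bar> \<le> B"
    and mixing: "\<And>n x. x \<in> space S \<Longrightarrow> \<bar>(markov_op \<mu> g ^^ n) \<phi> x - c\<bar> \<le> A * \<rho> ^ n"
    and close: "\<And>\<psi> b x. \<psi> \<in> borel_measurable S \<Longrightarrow> (\<And>x. x \<in> space S \<Longrightarrow> \<bar>\<psi> x\<bar> \<le> b) \<Longrightarrow>
        x \<in> space S \<Longrightarrow> \<bar>markov_op \<mu> f \<psi> x - markov_op \<mu> g \<psi> x\<bar> \<le> b * \<delta>"
    and rho: "0 \<le> \<rho>" "\<rho> < 1" and A: "0 \<le> A" and delta: "0 \<le> \<delta>" and x: "x \<in> space S"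
  shows "\<bar>(markov_op \<mu> f ^^ n) \<phi> x - (markov_op \<mu> g ^^ n) \<phi> x\<bar> \<le> A * \<delta> / (1 - \<rho>)"
proof -
  interpret f: random_map S \<mu> f by fact
  interpret g: random_map S \<mu> g by fact
  have telescope: "\<bar>(f.T ^^ n) \<phi> x - (g.T ^^ n) \<phi> x\<bar> \<le> A * \<delta> * (\<Sum>j<n. \<rho> ^ j)"
    if "x \<in> space S" for x
    using that
  proof (induction n arbitrary: x)
    case (Suc n)
    let ?F = "(f.T ^^ n) \<phi>" and ?G = "(g.T ^^ n) \<phi>"
    have F: "?F \<in> borel_measurable S" "\<And>y. y \<in> space S \<Longrightarrow> \<bar>?F y\<bar> \<le> B"
      using f.measurable_T_pow f.abs_T_pow_le phi by blast+
    have G: "?G \<in> borel_measurable S" "\<And>y. y \<in> space S \<Longrightarrow> \<bar>?G y\<bar> \<le> B"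
      using g.measurable_T_pow g.abs_T_pow_le phi by blast+
    have G': "(\<lambda>y. ?G y - c) \<in> borel_measurable S" using G by measurable
    have "\<bar>f.T (\<lambda>y. ?F y - ?G y) x\<bar> \<le> A * \<delta> * (\<Sum>j<n. \<rho> ^ j)"
      using F G Suc by (intro f.abs_T_le) auto
    moreover have "\<bar>f.T (\<lambda>y. ?G y - c) x - g.T (\<lambda>y. ?G y - c) x\<bar> \<le> A * \<rho> ^ n * \<delta>"
      using mixing Suc.prems by (intro close[OF G']) auto
    moreover have "f.T ?F x - g.T ?G x
        = f.T (\<lambda>y. ?F y - ?G y) x + (f.T (\<lambda>y. ?G y - c) x - g.T (\<lambda>y. ?G y - c) x)"
      using f.T_diff[OF F G Suc.prems] Suc.prems
        f.T_diff[OF G, of "\<lambda>_. c" "\<bar>c\<bar>"] g.T_diff[OF G, of "\<lambda>_. c" "\<bar>c\<bar>"]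
      by (simp add: f.T_const g.T_const)
    ultimately have "\<bar>f.T ?F x - g.T ?G x\<bar> \<le> A * \<delta> * (\<Sum>j<n. \<rho> ^ j) + A * \<rho> ^ n * \<delta>"
      by linarith
    also have "\<dots> = A * \<delta> * (\<Sum>j<Suc n. \<rho> ^ j)" by (simp add: algebra_simps)
    finally show ?case by simp
  qed simp
  have "(\<Sum>j<n. \<rho> ^ j) \<le> (\<Sum>j. \<rho> ^ j)"
    using rho by (intro sum_le_suminf summable_geometric) auto
  also have "\<dots> = 1 / (1 - \<rho>)" using rho by (simp add: suminf_geometric)
  finally have "A * \<delta> * (\<Sum>j<n. \<rho> ^ j) \<le> A * \<delta> * (1 / (1 - \<rho>))"
    using A delta by (intro mult_left_mono) auto
  with telescope[OF x] show ?thesis by simp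
qed

section \<open>Chains driven by independent innovations\<close>

lemma measurable_chain:
  assumes rm: "random_map S \<mu> \<xi>" and x: "x \<in> space S"
    and V: "\<And>i. 1 \<le> i \<Longrightarrow> i \<le> n \<Longrightarrow> V i \<in> M \<rightarrow>\<^sub>M \<mu>"
  shows "chain \<xi> x V n \<in> M \<rightarrow>\<^sub>M S"
  using V
proof (induction n)
  case 0
  have "chain \<xi> x V 0 = (\<lambda>_. x)" by (simp add: fun_eq_iff)
  then show ?case using x by simp
next
  case (Suc n)
  interpret random_map S \<mu> \<xi> by fact
  have [measurable]: "chain \<xi> x V n \<in> M \<rightarrow>\<^sub>M S" "V (Suc n) \<in> M \<rightarrow>\<^sub>M \<mu>"
    using Suc by auto
  note measurable_map[measurable]
  have "chain \<xi> x V (Suc n) = (\<lambda>\<omega>. \<xi> (chain \<xi> x V n \<omega>) (V (Suc n) \<omega>))"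
    by (simp add: fun_eq_iff)
  then show ?case by simp
qed

lemma chain_cong:
  assumes "\<And>i. 1 \<le> i \<Longrightarrow> i \<le> n \<Longrightarrow> V i \<omega> = V' i \<omega>'"
  shows "chain \<xi> x V n \<omega> = chain \<xi> x V' n \<omega>'"
  using assms by (induction n) auto

locale iid_innovations =
  fixes P :: "'w measure" and \<mu> :: "'u measure" and U :: "nat \<Rightarrow> 'w \<Rightarrow> 'u"
  assumes prob: "prob_space P"
    and indep: "prob_space.indep_vars P (\<lambda>_. \<mu>) U {1..}"
    and law: "\<And>n. 1 \<le> n \<Longrightarrow> distr P \<mu> (U n) = \<mu>"
begin

sublocale P: prob_space P by (rule prob)

lemma measurable_innovation: "1 \<le> n \<Longrightarrow> U n \<in> P \<rightarrow>\<^sub>M \<mu>"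
  using indep unfolding P.indep_vars_def by auto

text \<open>
  A factorisation through the first \<open>k\<close> innovations is stronger than measurability with
  respect to the generated \<open>\<sigma>\<close>-algebra for general \<open>R\<close>, but it is what independence is
  applied to, and it survives pairing and composition.
\<close>

definition adapted :: "nat \<Rightarrow> 'r measure \<Rightarrow> ('w \<Rightarrow> 'r) \<Rightarrow> bool" where
  "adapted k R W \<longleftrightarrow> (\<exists>w \<in> PiM {1..k} (\<lambda>_. \<mu>) \<rightarrow>\<^sub>M R. \<forall>\<omega>\<in>space P. W \<omega> = w (\<lambda>i\<in>{1..k}. U i \<omega>))"

lemma measurable_history: "(\<lambda>\<omega>. \<lambda>i\<in>{1..k}. U i \<omega>) \<in> P \<rightarrow>\<^sub>M PiM {1..k} (\<lambda>_. \<mu>)"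
  by (rule measurable_restrict) (auto intro: measurable_innovation)

lemma adapted_measurable:
  assumes "adapted k R W"
  shows "W \<in> P \<rightarrow>\<^sub>M R"
proof -
  obtain w where w: "w \<in> PiM {1..k} (\<lambda>_. \<mu>) \<rightarrow>\<^sub>M R" "\<And>\<omega>. \<omega> \<in> space P \<Longrightarrow> W \<omega> = w (\<lambda>i\<in>{1..k}. U i \<omega>)"
    using assms unfolding adapted_def by blast
  show ?thesis
    using measurable_compose[OF measurable_history w(1)] w(2) by (simp cong: measurable_cong)
qed

lemma adapted_mono:
  assumes "adapted k R W" "k \<le> m"
  shows "adapted m R W"
proof -
  obtain w where w: "w \<in> PiM {1..k} (\<lambda>_. \<mu>) \<rightarrow>\<^sub>M R" "\<And>\<omega>. \<omega> \<in> space P \<Longrightarrow> W \<omega> = w (\<lambda>i\<in>{1..k}. U i \<omega>)"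
    using assms unfolding adapted_def by blast
  have sub: "{1..k} \<subseteq> {1..m}" using assms(2) by auto
  have "(\<lambda>f. w (restrict f {1..k})) \<in> PiM {1..m} (\<lambda>_. \<mu>) \<rightarrow>\<^sub>M R"
    using measurable_compose[OF measurable_restrict_subset[OF sub] w(1)] .
  moreover have "W \<omega> = w (restrict (\<lambda>i\<in>{1..m}. U i \<omega>) {1..k})" if "\<omega> \<in> space P" for \<omega>
    using w(2)[OF that] sub by (simp only: restrict_restrict Int_absorb1)
  ultimately show ?thesis unfolding adapted_def by (intro bexI) auto
qed

lemma adapted_Pair:
  assumes "adapted k R W" "adapted k R' W'"
  shows "adapted k (R \<Otimes>\<^sub>M R') (\<lambda>\<omega>. (W \<omega>, W' \<omega>))"
proof -
  obtain w w' where "w \<in> PiM {1..k} (\<lambda>_. \<mu>) \<rightarrow>\<^sub>M R" "\<forall>\<omega>\<in>space P. W \<omega> = w (\<lambda>i\<in>{1..k}. U i \<omega>)"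
    "w' \<in> PiM {1..k} (\<lambda>_. \<mu>) \<rightarrow>\<^sub>M R'" "\<forall>\<omega>\<in>space P. W' \<omega> = w' (\<lambda>i\<in>{1..k}. U i \<omega>)"
    using assms unfolding adapted_def by blast
  then show ?thesis unfolding adapted_def by (intro bexI[of _ "\<lambda>v. (w v, w' v)"]) auto
qed

lemma adapted_compose:
  assumes "adapted k R W" "f \<in> R \<rightarrow>\<^sub>M R'"
  shows "adapted k R' (\<lambda>\<omega>. f (W \<omega>))"
proof -
  obtain w where "w \<in> PiM {1..k} (\<lambda>_. \<mu>) \<rightarrow>\<^sub>M R" "\<forall>\<omega>\<in>space P. W \<omega> = w (\<lambda>i\<in>{1..k}. U i \<omega>)"
    using assms unfolding adapted_def by blast
  then show ?thesis using assms(2) unfolding adapted_def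
    by (intro bexI[of _ "\<lambda>v. f (w v)"]) auto
qed

lemma adapted_chain:
  assumes "random_map S \<mu> \<xi>" "x \<in> space S"
  shows "adapted n S (chain \<xi> x U n)"
proof -
  have "chain \<xi> x (\<lambda>i v. v i) n \<in> PiM {1..n} (\<lambda>_. \<mu>) \<rightarrow>\<^sub>M S"
    by (rule measurable_chain[OF assms]) (auto intro: measurable_component_singleton)
  moreover have "chain \<xi> x U n \<omega> = chain \<xi> x (\<lambda>i v. v i) n (\<lambda>i\<in>{1..n}. U i \<omega>)" for \<omega>
    by (rule chain_cong) auto
  ultimately show ?thesis unfolding adapted_def by blast
qed

text \<open>
  The next innovation is independent of the past, so it can be integrated out first.
\<close>

lemma expectation_next_innovation:
  fixes G :: "'r \<Rightarrow> 'u \<Rightarrow> real"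
  assumes W: "adapted k R W"
    and G[measurable]: "(\<lambda>(w, u). G w u) \<in> borel_measurable (R \<Otimes>\<^sub>M \<mu>)"
    and bound: "\<And>w u. w \<in> space R \<Longrightarrow> u \<in> space \<mu> \<Longrightarrow> \<bar>G w u\<bar> \<le> B"
  shows "P.expectation (\<lambda>\<omega>. G (W \<omega>) (U (Suc k) \<omega>)) = P.expectation (\<lambda>\<omega>. \<integral>u. G (W \<omega>) u \<partial>\<mu>)"
proof -
  obtain w where w: "w \<in> PiM {1..k} (\<lambda>_. \<mu>) \<rightarrow>\<^sub>M R" "\<And>\<omega>. \<omega> \<in> space P \<Longrightarrow> W \<omega> = w (\<lambda>i\<in>{1..k}. U i \<omega>)"
    using W unfolding adapted_def by blast
  \<comment> \<open>Independence of two variables is defined for values of a single type, so it is applied to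
    the restricted families of innovations rather than to \<open>W\<close> and \<open>U (Suc k)\<close>.\<close>
  let ?past = "\<lambda>\<omega>. \<lambda>i\<in>{1..k}. U i \<omega>" and ?next = "\<lambda>\<omega>. \<lambda>i\<in>{Suc k}. U i \<omega>"
  let ?A = "PiM {1..k} (\<lambda>_. \<mu>)" and ?B = "PiM {Suc k} (\<lambda>_. \<mu>)"
  have ind: "P.indep_var ?A ?past ?B ?next"
    by (rule P.indep_var_restrict[OF indep]) auto
  then have past[measurable]: "?past \<in> P \<rightarrow>\<^sub>M ?A" and nxt[measurable]: "?next \<in> P \<rightarrow>\<^sub>M ?B"
    and distr: "distr P ?A ?past \<Otimes>\<^sub>M distr P ?B ?next = distr P (?A \<Otimes>\<^sub>M ?B) (\<lambda>\<omega>. (?past \<omega>, ?next \<omega>))"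
    by (simp_all only: P.indep_var_distribution_eq)
  have w_meas[measurable]: "w \<in> ?A \<rightarrow>\<^sub>M R" by (rule w(1))
  have eval[measurable]: "(\<lambda>v. v (Suc k)) \<in> ?B \<rightarrow>\<^sub>M \<mu>"
    by (rule measurable_component_singleton) simp
  have U[measurable]: "U (Suc k) \<in> P \<rightarrow>\<^sub>M \<mu>" by (rule measurable_innovation) simp
  interpret past: prob_space "distr P ?A ?past" by (rule P.prob_space_distr[OF past])
  interpret nxt: prob_space "distr P ?B ?next" by (rule P.prob_space_distr[OF nxt])
  interpret pair: pair_prob_space "distr P ?A ?past" "distr P ?B ?next" ..
  let ?H = "\<lambda>v v'. G (w v) (v' (Suc k))"
  have H: "(\<lambda>(v, v'). ?H v v') \<in> borel_measurable (?A \<Otimes>\<^sub>M ?B)" by measurable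
  have at: "?H v \<in> borel_measurable ?B" if "v \<in> space ?A" for v
    using measurable_compose_Pair1[OF that H] by simp
  have inner: "(\<integral>v'. ?H v v' \<partial>distr P ?B ?next) = (\<integral>u. G (w v) u \<partial>\<mu>)" if v: "v \<in> space ?A" for v
  proof -
    have "w v \<in> space R" using measurable_space[OF w(1) v] .
    then have Gw: "G (w v) \<in> borel_measurable \<mu>"
      using measurable_compose_Pair1[OF _ G] by simp
    have "(\<integral>v'. ?H v v' \<partial>distr P ?B ?next) = P.expectation (\<lambda>\<omega>. G (w v) (U (Suc k) \<omega>))"
      using integral_distr[OF nxt at[OF v]] by simp
    also have "\<dots> = (\<integral>u. G (w v) u \<partial>distr P \<mu> (U (Suc k)))"
      by (rule integral_distr[OF U Gw, symmetric])
    finally show ?thesis using law[of "Suc k"] by simp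
  qed
  have meas: "(\<lambda>(v, v'). ?H v v') \<in> borel_measurable (distr P ?A ?past \<Otimes>\<^sub>M distr P ?B ?next)"
    using H by (simp cong: measurable_cong_sets)
  have "integrable (distr P ?A ?past \<Otimes>\<^sub>M distr P ?B ?next) (\<lambda>(v, v'). ?H v v')"
    using bound measurable_space[OF w_meas] measurable_space[OF eval]
    by (intro integrable_bounded[where B=B, OF pair.P.finite_measure_axioms meas])
      (auto simp: space_pair_measure)
  then have "(\<integral>v. (\<integral>v'. ?H v v' \<partial>distr P ?B ?next) \<partial>distr P ?A ?past)
      = (\<integral>(v, v'). ?H v v' \<partial>(distr P ?A ?past \<Otimes>\<^sub>M distr P ?B ?next))"
    by (rule pair.integral_fst)
  also have "\<dots> = P.expectation (\<lambda>\<omega>. ?H (?past \<omega>) (?next \<omega>))"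
    unfolding distr by (subst integral_distr[OF measurable_Pair[OF past nxt] H]) simp
  also have "\<dots> = P.expectation (\<lambda>\<omega>. G (W \<omega>) (U (Suc k) \<omega>))"
    using w(2) by (intro Bochner_Integration.integral_cong) auto
  finally have "P.expectation (\<lambda>\<omega>. G (W \<omega>) (U (Suc k) \<omega>))
      = (\<integral>v. (\<integral>v'. ?H v v' \<partial>distr P ?B ?next) \<partial>distr P ?A ?past)" by simp
  also have "\<dots> = P.expectation (\<lambda>\<omega>. \<integral>v'. ?H (?past \<omega>) v' \<partial>distr P ?B ?next)"
    using nxt.borel_measurable_lebesgue_integral[of "\<lambda>v v'. ?H v v'" ?A] H
    by (intro integral_distr past) (simp cong: measurable_cong_sets)
  also have "\<dots> = P.expectation (\<lambda>\<omega>. \<integral>u. G (W \<omega>) u \<partial>\<mu>)"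
    using w(2) inner measurable_space[OF past]
    by (intro Bochner_Integration.integral_cong) auto
  finally show ?thesis .
qed

text \<open>
  This is the Markov property, tested against the past \<open>W\<close>.
\<close>

lemma expectation_chain_add:
  assumes rm: "random_map S \<mu> \<xi>" and x: "x \<in> space S"
    and W: "adapted n borel W" and W_bound: "\<And>\<omega>. \<omega> \<in> space P \<Longrightarrow> \<bar>W \<omega>\<bar> \<le> b"
    and phi: "\<phi> \<in> borel_measurable S" "\<And>y. y \<in> space S \<Longrightarrow> \<bar>\<phi> y\<bar> \<le> B"
  shows "P.expectation (\<lambda>\<omega>. W \<omega> * \<phi> (chain \<xi> x U (n + m) \<omega>))
      = P.expectation (\<lambda>\<omega>. W \<omega> * (markov_op \<mu> \<xi> ^^ m) \<phi> (chain \<xi> x U n \<omega>))"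
  using phi
proof (induction m arbitrary: \<phi>)
  case (Suc m)
  interpret random_map S \<mu> \<xi> by fact
  note [measurable] = measurable_map Suc.prems(1)
  \<comment> \<open>Clipping does not change the values of \<open>W\<close>, and it makes \<open>G\<close> bounded for all real \<open>w\<close>.\<close>
  define G where "G = (\<lambda>(w, y) u. max (- b) (min b w) * \<phi> (\<xi> y u))"
  have clip: "max (- b) (min b (W \<omega>)) = W \<omega>" if "\<omega> \<in> space P" for \<omega>
    using W_bound[OF that] by linarith
  have past: "adapted (n + m) (borel \<Otimes>\<^sub>M S) (\<lambda>\<omega>. (W \<omega>, chain \<xi> x U (n + m) \<omega>))"
    using W by (intro adapted_Pair adapted_chain[OF rm x]) (auto intro: adapted_mono)
  have meas: "(\<lambda>(z, u). G z u) \<in> borel_measurable ((borel \<Otimes>\<^sub>M S) \<Otimes>\<^sub>M \<mu>)"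
    unfolding G_def split_beta' by measurable
  have bound: "\<bar>G z u\<bar> \<le> \<bar>b\<bar> * B" if "z \<in> space (borel \<Otimes>\<^sub>M S)" "u \<in> space \<mu>" for z u
  proof -
    obtain w y where z: "z = (w, y)" by (cases z)
    then have "y \<in> space S" using that(1) by (simp add: space_pair_measure)
    have "\<bar>max (- b) (min b w)\<bar> \<le> \<bar>b\<bar>" by linarith
    moreover have "\<bar>\<phi> (\<xi> y u)\<bar> \<le> B" using Suc.prems(2) map_in \<open>y \<in> space S\<close> that(2) by blast
    ultimately show ?thesis unfolding G_def z abs_mult split_conv by (intro mult_mono) auto
  qed
  have "P.expectation (\<lambda>\<omega>. W \<omega> * \<phi> (chain \<xi> x U (n + Suc m) \<omega>))
      = P.expectation (\<lambda>\<omega>. G (W \<omega>, chain \<xi> x U (n + m) \<omega>) (U (Suc (n + m)) \<omega>))"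
    by (intro Bochner_Integration.integral_cong) (auto simp: G_def clip)
  also have "\<dots> = P.expectation (\<lambda>\<omega>. \<integral>u. G (W \<omega>, chain \<xi> x U (n + m) \<omega>) u \<partial>\<mu>)"
    by (rule expectation_next_innovation[OF past meas bound])
  also have "\<dots> = P.expectation (\<lambda>\<omega>. W \<omega> * T \<phi> (chain \<xi> x U (n + m) \<omega>))"
    by (intro Bochner_Integration.integral_cong) (auto simp: G_def clip markov_op_def)
  also have "\<dots> = P.expectation (\<lambda>\<omega>. W \<omega> * (T ^^ m) (T \<phi>) (chain \<xi> x U n \<omega>))"
    using Suc.prems by (intro Suc.IH measurable_T abs_T_le)
  finally show ?case by (simp add: funpow_swap1)
qed simp

end

section \<open>Second moments\<close>

lemma sum_power_diff_le:
  fixes r :: real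
  assumes "0 \<le> r" "r < 1"
  shows "(\<Sum>i=1..N. r ^ (Suc N - i)) \<le> r / (1 - r)"
proof (induction N)
  case (Suc N)
  have "(\<Sum>i=1..Suc N. r ^ (Suc (Suc N) - i)) = r * (\<Sum>i=1..N. r ^ (Suc N - i)) + r"
    by (simp add: sum_distrib_left Suc_diff_le)
  also have "\<dots> \<le> r * (r / (1 - r)) + r"
    using Suc assms by (intro add_right_mono mult_left_mono) auto
  also have "\<dots> = r / (1 - r)" using assms by (simp add: field_simps)
  finally show ?case .
qed (use assms in simp)

text \<open>
  When correlations decay geometrically, adding one more term to the sum raises its second
  moment by at most \<open>A + 2 * A * r / (1 - r)\<close>, so the second moment grows only linearly.
\<close>

lemma (in prob_space) second_moment_sum_le:
  fixes D :: "nat \<Rightarrow> 'a \<Rightarrow> real"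
  assumes D[measurable]: "\<And>n. D n \<in> borel_measurable M"
    and bound: "\<And>n \<omega>. \<omega> \<in> space M \<Longrightarrow> \<bar>D n \<omega>\<bar> \<le> b"
    and corr: "\<And>i m. 1 \<le> i \<Longrightarrow> expectation (\<lambda>\<omega>. D i \<omega> * D (i + m) \<omega>) \<le> A * r ^ m"
    and r: "0 \<le> r" "r < 1" and A: "0 \<le> A"
  shows "expectation (\<lambda>\<omega>. (\<Sum>n=1..N. D n \<omega>)\<^sup>2) \<le> real N * (2 * A / (1 - r))"
proof (induction N)
  case (Suc N)
  let ?S = "\<lambda>\<omega>. \<Sum>n=1..N. D n \<omega>"
  have int_DD: "integrable M (\<lambda>\<omega>. D i \<omega> * D j \<omega>)" for i j
  proof (rule integrable_bounded[where B="b * b"])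
    fix \<omega> assume "\<omega> \<in> space M"
    then show "\<bar>D i \<omega> * D j \<omega>\<bar> \<le> b * b"
      using bound[of \<omega> i] bound[of \<omega> j] unfolding abs_mult by (intro mult_mono) auto
  qed (use finite_measure_axioms in auto)
  have int_SD: "integrable M (\<lambda>\<omega>. ?S \<omega> * D j \<omega>)" for j
    unfolding sum_distrib_right by (intro Bochner_Integration.integrable_sum int_DD)
  have int_SS: "integrable M (\<lambda>\<omega>. (?S \<omega>)\<^sup>2)"
    unfolding power2_eq_square sum_product
    by (intro Bochner_Integration.integrable_sum int_DD)
  have "expectation (\<lambda>\<omega>. ?S \<omega> * D (Suc N) \<omega>) = (\<Sum>i=1..N. expectation (\<lambda>\<omega>. D i \<omega> * D (Suc N) \<omega>))"
    unfolding sum_distrib_right by (intro Bochner_Integration.integral_sum int_DD)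
  also have "\<dots> \<le> (\<Sum>i=1..N. A * r ^ (Suc N - i))"
  proof (rule sum_mono)
    fix i assume "i \<in> {1..N}"
    then show "expectation (\<lambda>\<omega>. D i \<omega> * D (Suc N) \<omega>) \<le> A * r ^ (Suc N - i)"
      using corr[of i "Suc N - i"] by simp
  qed
  also have "\<dots> \<le> A * (r / (1 - r))"
    unfolding sum_distrib_left[symmetric] by (rule mult_left_mono[OF sum_power_diff_le[OF r] A])
  finally have cross: "expectation (\<lambda>\<omega>. ?S \<omega> * D (Suc N) \<omega>) \<le> A * (r / (1 - r))" .
  have diag: "expectation (\<lambda>\<omega>. D (Suc N) \<omega> * D (Suc N) \<omega>) \<le> A"
    using corr[of "Suc N" 0] by simp
  have "(\<lambda>\<omega>. (\<Sum>n=1..Suc N. D n \<omega>)\<^sup>2)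
      = (\<lambda>\<omega>. (?S \<omega>)\<^sup>2 + 2 * (?S \<omega> * D (Suc N) \<omega>) + D (Suc N) \<omega> * D (Suc N) \<omega>)"
    by (simp add: fun_eq_iff power2_eq_square algebra_simps)
  then have "expectation (\<lambda>\<omega>. (\<Sum>n=1..Suc N. D n \<omega>)\<^sup>2)
      = expectation (\<lambda>\<omega>. (?S \<omega>)\<^sup>2) + 2 * expectation (\<lambda>\<omega>. ?S \<omega> * D (Suc N) \<omega>)
        + expectation (\<lambda>\<omega>. D (Suc N) \<omega> * D (Suc N) \<omega>)"
    using int_SS int_SD int_DD by simp
  also have "\<dots> \<le> real N * (2 * A / (1 - r)) + 2 * (A * (r / (1 - r))) + A"
    using Suc.IH cross diag by linarith
  also have "\<dots> \<le> real N * (2 * A / (1 - r)) + 2 * A / (1 - r)"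
  proof -
    have "2 * (A * (r / (1 - r))) + A = 2 * A / (1 - r) - A"
      using r by (simp add: field_simps)
    with A show ?thesis by linarith
  qed
  also have "\<dots> = real (Suc N) * (2 * A / (1 - r))" by (simp add: algebra_simps add_divide_distrib)
  finally show ?case .
qed simp

context iid_innovations
begin

text \<open>
  One step of the coupled chains changes the squared distance in two ways: \<open>f\<close> contracts
  the old distance, and the difference of \<open>f\<close> and \<open>g\<close> adds at most \<open>c\<close> on average. Young's
  inequality with a weight that keeps the contraction factor at \<open>(1 + \<tau>) / 2 < 1\<close> separates
  the two, and the stated bound is the fixed point of the resulting recursion.
\<close>

lemma expectation_coupled_distance_le:
  fixes d :: "'a \<Rightarrow> 'a \<Rightarrow> real"
  assumes f: "random_map S \<mu> f" and g: "random_map S \<mu> g" and x: "x \<in> space S"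
    and d_meas: "(\<lambda>(x, y). d x y) \<in> borel_measurable (S \<Otimes>\<^sub>M S)"
    and d_range: "\<And>x y. x \<in> space S \<Longrightarrow> y \<in> space S \<Longrightarrow> 0 \<le> d x y \<and> d x y \<le> D"
    and d_self: "\<And>x. d x x = 0" and d_triangle: "\<And>x y z. d x z \<le> d x y + d y z"
    and tau: "0 < \<tau>" "\<tau> < 1"
    and contr: "\<And>x y. x \<in> space S \<Longrightarrow> y \<in> space S \<Longrightarrow>
        (\<integral>u. (d (f x u) (f y u))\<^sup>2 \<partial>\<mu>) \<le> \<tau> * (d x y)\<^sup>2"
    and close: "\<And>x. x \<in> space S \<Longrightarrow> (\<integral>u. (d (f x u) (g x u))\<^sup>2 \<partial>\<mu>) \<le> c"
  shows "P.expectation (\<lambda>\<omega>. (d (chain f x U n \<omega>) (chain g x U n \<omega>))\<^sup>2)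
      \<le> 2 * (1 + \<tau>) / (1 - \<tau>)\<^sup>2 * c"
proof (induction n)
  case 0
  have "0 \<le> (\<integral>u. (d (f x u) (g x u))\<^sup>2 \<partial>\<mu>)" by (rule integral_nonneg_AE) simp
  then have "0 \<le> c" using close[OF x] by linarith
  then show ?case using tau by (simp add: d_self)
next
  case (Suc n)
  interpret f: random_map S \<mu> f by fact
  interpret g: random_map S \<mu> g by fact
  note [measurable] = f.measurable_map g.measurable_map
  let ?Z = "\<lambda>\<omega>. (chain f x U n \<omega>, chain g x U n \<omega>)"
  let ?G = "\<lambda>(a, b) u. (d (f a u) (g b u))\<^sup>2"
  have Z: "adapted n (S \<Otimes>\<^sub>M S) ?Z" by (intro adapted_Pair adapted_chain f g x)
  have chain_f[measurable]: "chain f x U n \<in> P \<rightarrow>\<^sub>M S" by (rule measurable_chain[OF f x measurable_innovation])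
  have chain_g[measurable]: "chain g x U n \<in> P \<rightarrow>\<^sub>M S" by (rule measurable_chain[OF g x measurable_innovation])
  have d_app[measurable]: "(\<lambda>\<omega>. d (F \<omega>) (G \<omega>)) \<in> borel_measurable M"
    if [measurable]: "F \<in> M \<rightarrow>\<^sub>M S" "G \<in> M \<rightarrow>\<^sub>M S" for F G and M :: "'z measure"
    using measurable_compose[OF measurable_Pair[OF that] d_meas] by simp
  have sq: "(d a b)\<^sup>2 \<le> D\<^sup>2" if "a \<in> space S" "b \<in> space S" for a b
    using d_range[OF that] by (intro power_mono) auto
  have int_d: "integrable \<mu> (\<lambda>u. (d (F u) (G u))\<^sup>2)" if "F \<in> \<mu> \<rightarrow>\<^sub>M S" "G \<in> \<mu> \<rightarrow>\<^sub>M S" for F G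
  proof (rule integrable_bounded[where B="D\<^sup>2", OF f.\<mu>.finite_measure_axioms])
    show "(\<lambda>u. (d (F u) (G u))\<^sup>2) \<in> borel_measurable \<mu>"
      using measurable_compose[OF measurable_Pair[OF that] d_meas] by simp
  qed (use sq measurable_space[OF that(1)] measurable_space[OF that(2)] in auto)
  define \<delta> where "\<delta> = (1 - \<tau>) / (2 * \<tau>)"
  have delta: "0 < \<delta>" "(1 + \<delta>) * \<tau> = (1 + \<tau>) / 2" "1 + 1 / \<delta> = (1 + \<tau>) / (1 - \<tau>)"
    using tau by (auto simp: \<delta>_def field_simps)
  have young: "(p + q)\<^sup>2 \<le> (1 + \<delta>) * p\<^sup>2 + (1 + 1 / \<delta>) * q\<^sup>2" for p q :: real
  proof -
    have "0 \<le> (\<delta> * p - q)\<^sup>2 / \<delta>" using delta(1) by simp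
    also have "\<dots> = (1 + \<delta>) * p\<^sup>2 + (1 + 1 / \<delta>) * q\<^sup>2 - (p + q)\<^sup>2"
      using delta(1) by (simp add: power2_eq_square field_simps)
    finally show ?thesis by simp
  qed
  have step: "(\<integral>u. (d (f a u) (g b u))\<^sup>2 \<partial>\<mu>) \<le> (1 + \<tau>) / 2 * (d a b)\<^sup>2 + (1 + \<tau>) / (1 - \<tau>) * c"
    if ab: "a \<in> space S" "b \<in> space S" for a b
  proof -
    note at = f.measurable_map_at[OF ab(1)] f.measurable_map_at[OF ab(2)] g.measurable_map_at[OF ab(2)]
    have "(\<integral>u. (d (f a u) (g b u))\<^sup>2 \<partial>\<mu>)
        \<le> (\<integral>u. (1 + \<delta>) * (d (f a u) (f b u))\<^sup>2 + (1 + 1 / \<delta>) * (d (f b u) (g b u))\<^sup>2 \<partial>\<mu>)"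
    proof (rule integral_mono)
      fix u assume u: "u \<in> space \<mu>"
      have "(d (f a u) (g b u))\<^sup>2 \<le> (d (f a u) (f b u) + d (f b u) (g b u))\<^sup>2"
        using d_range[OF f.map_in[OF ab(1) u] g.map_in[OF ab(2) u]] d_triangle
        by (intro power_mono) auto
      also note young
      finally show "(d (f a u) (g b u))\<^sup>2
          \<le> (1 + \<delta>) * (d (f a u) (f b u))\<^sup>2 + (1 + 1 / \<delta>) * (d (f b u) (g b u))\<^sup>2" .
    qed (use int_d at in auto)
    also have "\<dots> = (1 + \<delta>) * (\<integral>u. (d (f a u) (f b u))\<^sup>2 \<partial>\<mu>)
        + (1 + 1 / \<delta>) * (\<integral>u. (d (f b u) (g b u))\<^sup>2 \<partial>\<mu>)"
      using int_d at by simp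
    also have "\<dots> \<le> (1 + \<delta>) * (\<tau> * (d a b)\<^sup>2) + (1 + 1 / \<delta>) * c"
      using contr[OF ab] close[OF ab(2)] delta(1) by (intro add_mono mult_left_mono) auto
    also have "\<dots> = (1 + \<tau>) / 2 * (d a b)\<^sup>2 + (1 + \<tau>) / (1 - \<tau>) * c"
      using delta(2,3) by (metis mult.assoc)
    finally show ?thesis .
  qed
  have in_S: "chain f x U n \<omega> \<in> space S" "chain g x U n \<omega> \<in> space S" if "\<omega> \<in> space P" for \<omega>
    using measurable_space[OF chain_f that] measurable_space[OF chain_g that] .
  have meas_G: "(\<lambda>(z, u). ?G z u) \<in> borel_measurable ((S \<Otimes>\<^sub>M S) \<Otimes>\<^sub>M \<mu>)"
    unfolding split_beta' by measurable
  have bound_G: "\<bar>?G z u\<bar> \<le> D\<^sup>2" if "z \<in> space (S \<Otimes>\<^sub>M S)" "u \<in> space \<mu>" for z u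
    using that sq f.map_in g.map_in by (auto simp: space_pair_measure)
  have meas_d: "(\<lambda>\<omega>. d (chain f x U n \<omega>) (chain g x U n \<omega>)) \<in> borel_measurable P"
    by measurable
  have int: "integrable P (\<lambda>\<omega>. (d (chain f x U n \<omega>) (chain g x U n \<omega>))\<^sup>2)"
    using meas_d in_S sq by (intro integrable_bounded[where B="D\<^sup>2"] P.finite_measure_axioms) auto
  have "P.expectation (\<lambda>\<omega>. (d (chain f x U (Suc n) \<omega>) (chain g x U (Suc n) \<omega>))\<^sup>2)
      = P.expectation (\<lambda>\<omega>. ?G (?Z \<omega>) (U (Suc n) \<omega>))" by simp
  also have "\<dots> = P.expectation (\<lambda>\<omega>. \<integral>u. ?G (?Z \<omega>) u \<partial>\<mu>)"
    by (rule expectation_next_innovation[OF Z meas_G bound_G])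
  also have "\<dots> \<le> P.expectation (\<lambda>\<omega>. (1 + \<tau>) / 2 * (d (chain f x U n \<omega>) (chain g x U n \<omega>))\<^sup>2
      + (1 + \<tau>) / (1 - \<tau>) * c)"
  proof (rule integral_mono)
    have "(\<lambda>\<omega>. \<integral>u. ?G (?Z \<omega>) u \<partial>\<mu>) \<in> borel_measurable P"
      using measurable_compose[OF adapted_measurable[OF Z]
          f.\<mu>.borel_measurable_lebesgue_integral[OF meas_G]] .
    then show "integrable P (\<lambda>\<omega>. \<integral>u. ?G (?Z \<omega>) u \<partial>\<mu>)"
    proof (rule integrable_bounded[where B="D\<^sup>2", OF P.finite_measure_axioms])
      fix \<omega> assume \<omega>: "\<omega> \<in> space P"
      then have z: "?Z \<omega> \<in> space (S \<Otimes>\<^sub>M S)" using in_S by (simp add: space_pair_measure)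
      show "\<bar>\<integral>u. ?G (?Z \<omega>) u \<partial>\<mu>\<bar> \<le> D\<^sup>2"
        using measurable_compose_Pair1[OF z meas_G] bound_G[OF z]
        by (intro abs_integral_le_bound f.prob_innovation) auto
    qed
    show "(\<integral>u. ?G (?Z \<omega>) u \<partial>\<mu>) \<le> (1 + \<tau>) / 2 * (d (chain f x U n \<omega>) (chain g x U n \<omega>))\<^sup>2
        + (1 + \<tau>) / (1 - \<tau>) * c" if "\<omega> \<in> space P" for \<omega>
      using step[OF in_S[OF that]] by simp
  qed (use int in simp)
  also have "\<dots> = (1 + \<tau>) / 2 * P.expectation (\<lambda>\<omega>. (d (chain f x U n \<omega>) (chain g x U n \<omega>))\<^sup>2)
      + (1 + \<tau>) / (1 - \<tau>) * c"
    using int by (simp add: P.prob_space)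
  also have "\<dots> \<le> (1 + \<tau>) / 2 * (2 * (1 + \<tau>) / (1 - \<tau>)\<^sup>2 * c) + (1 + \<tau>) / (1 - \<tau>) * c"
    using Suc.IH tau by (intro add_right_mono mult_left_mono) auto
  also have "\<dots> = 2 * (1 + \<tau>) / (1 - \<tau>)\<^sup>2 * c"
  proof -
    have "1 - \<tau> \<noteq> 0" using tau by simp
    then show ?thesis by (simp add: power2_eq_square divide_simps) (simp add: algebra_simps)
  qed
  finally show ?case .
qed

end

section \<open>The variance of the coupled averages\<close>

text \<open>
  Given the pair of chains at time \<open>i\<close>, the conditional mean of the centred difference \<open>m\<close>
  steps later is \<open>H m\<close> at that pair. It splits into a coupling part, small because \<open>f\<close>
  contracts, and a part at the single point of \<open>g\<close>'s chain. The latter is at most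
  \<open>2 * M * A * \<rho> ^ m\<close> by mixing and at most \<open>M * \<eta>\<close> by closeness of the kernels.
  The first bound is not small in \<open>\<eta>\<close> and the second does not decay in \<open>m\<close>; their geometric
  mean does both, and its square is of the required order \<open>\<eta>\<close>.
\<close>

lemma (in iid_innovations) expectation_coupled_average_le:
  fixes d :: "'a \<Rightarrow> 'a \<Rightarrow> real"
  assumes f: "random_map S \<mu> f" and g: "random_map S \<mu> g" and x: "x \<in> space S"
    and d_meas: "(\<lambda>(x, y). d x y) \<in> borel_measurable (S \<Otimes>\<^sub>M S)"
    and d_range: "\<And>x y. x \<in> space S \<Longrightarrow> y \<in> space S \<Longrightarrow> 0 \<le> d x y \<and> d x y \<le> B"
    and d_self: "\<And>x. d x x = 0" and d_triangle: "\<And>x y z. d x z \<le> d x y + d y z"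
    and tau: "0 < \<tau>" "\<tau> < 1" and rho: "0 < \<rho>" "\<rho> < 1"
    and contr: "\<And>x y. x \<in> space S \<Longrightarrow> y \<in> space S \<Longrightarrow>
        (\<integral>u. (d (f x u) (f y u))\<^sup>2 \<partial>\<mu>) \<le> \<tau> * (d x y)\<^sup>2"
    and close: "\<And>x. x \<in> space S \<Longrightarrow> (\<integral>u. (d (f x u) (g x u))\<^sup>2 \<partial>\<mu>) \<le> c"
    and phi: "\<phi> \<in> borel_measurable S" "\<And>y. y \<in> space S \<Longrightarrow> \<bar>\<phi> y\<bar> \<le> M"
    and Lip: "\<And>x y. x \<in> space S \<Longrightarrow> y \<in> space S \<Longrightarrow> \<bar>\<phi> x - \<phi> y\<bar> \<le> M * d x y"
    and mixing_f: "\<And>n y. y \<in> space S \<Longrightarrow> \<bar>(markov_op \<mu> f ^^ n) \<phi> y - cf\<bar> \<le> M * A * \<rho> ^ n"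
    and mixing_g: "\<And>n y. y \<in> space S \<Longrightarrow> \<bar>(markov_op \<mu> g ^^ n) \<phi> y - cg\<bar> \<le> M * A * \<rho> ^ n"
    and near: "\<And>n y. y \<in> space S \<Longrightarrow>
        \<bar>(markov_op \<mu> f ^^ n) \<phi> y - cf - ((markov_op \<mu> g ^^ n) \<phi> y - cg)\<bar> \<le> M * \<eta>"
    and A: "0 \<le> A" and eta: "0 \<le> \<eta>" and N: "1 \<le> N"
  shows "P.expectation (\<lambda>\<omega>. (1 / real N *
        (\<Sum>n=1..N. (\<phi> (chain f x U n \<omega>) - \<phi> (chain g x U n \<omega>)) - (cf - cg)))\<^sup>2)
      \<le> M\<^sup>2 * (4 * (2 * (1 + \<tau>) / (1 - \<tau>)\<^sup>2 * c + 2 * A * \<eta>) / (1 - max (sqrt \<tau>) (sqrt \<rho>))) / real N"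
proof -
  interpret f: random_map S \<mu> f by fact
  interpret g: random_map S \<mu> g by fact
  define r where "r = max (sqrt \<tau>) (sqrt \<rho>)"
  define s where "s = sqrt (2 * A * \<eta>)"
  define K where "K = 2 * (1 + \<tau>) / (1 - \<tau>)\<^sup>2 * c"
  define H where "H m a b = ((f.T ^^ m) \<phi> a - cf) - ((g.T ^^ m) \<phi> b - cg)" for m a b
  define D where "D n \<omega> = H 0 (chain f x U n \<omega>) (chain g x U n \<omega>)" for n \<omega>
  let ?d = "\<lambda>n \<omega>. d (chain f x U n \<omega>) (chain g x U n \<omega>)"
  have r: "0 \<le> r" "r < 1" using tau rho by (auto simp: r_def le_max_iff_disj)
  have s: "0 \<le> s" "s\<^sup>2 = 2 * A * \<eta>" using A eta by (auto simp: s_def)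
  have M: "0 \<le> M" using phi(2)[OF x] by linarith
  have chain_f[measurable]: "chain f x U n \<in> P \<rightarrow>\<^sub>M S" for n
    by (rule measurable_chain[OF f x measurable_innovation])
  have chain_g[measurable]: "chain g x U n \<in> P \<rightarrow>\<^sub>M S" for n
    by (rule measurable_chain[OF g x measurable_innovation])
  have in_S: "chain f x U n \<omega> \<in> space S" "chain g x U n \<omega> \<in> space S" if "\<omega> \<in> space P" for n \<omega>
    using measurable_space[OF chain_f that] measurable_space[OF chain_g that] .
  have [measurable]: "(f.T ^^ m) \<phi> \<in> borel_measurable S" "(g.T ^^ m) \<phi> \<in> borel_measurable S" for m
    using f.measurable_T_pow g.measurable_T_pow phi(1) by auto
  have d_meas'[measurable]: "?d n \<in> borel_measurable P" for n
    using measurable_compose[OF measurable_Pair[OF chain_f chain_g] d_meas] by simp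
  have H_meas[measurable]: "(\<lambda>\<omega>. H m (chain f x U n \<omega>) (chain g x U n \<omega>)) \<in> borel_measurable P" for m n
    unfolding H_def by measurable
  have D_meas: "D n \<in> borel_measurable P" for n
    using H_meas[of 0 n] by (simp add: D_def[abs_def])
  have H_le: "\<bar>H m a b\<bar> \<le> M * r ^ m * (d a b + s)" if ab: "a \<in> space S" "b \<in> space S" for m a b
  proof -
    have d0: "0 \<le> d a b" using d_range[OF ab] by simp
    have "\<bar>(f.T ^^ m) \<phi> a - (f.T ^^ m) \<phi> b\<bar> \<le> M * sqrt \<tau> ^ m * d a b"
      using f.T_pow_Lipschitz[OF d_meas d_range contr _ phi Lip M ab] tau by simp
    also have "\<dots> \<le> M * r ^ m * d a b"
      using M tau d0 by (intro mult_right_mono mult_left_mono power_mono) (auto simp: r_def)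
    finally have coupling: "\<bar>(f.T ^^ m) \<phi> a - (f.T ^^ m) \<phi> b\<bar> \<le> M * r ^ m * d a b" .
    let ?e = "\<bar>H m b b\<bar>"
    have "?e \<le> M * (2 * A * \<rho> ^ m)"
      using mixing_f[OF ab(2), of m] mixing_g[OF ab(2), of m] by (simp add: H_def)
    moreover have "?e \<le> M * \<eta>" using near[OF ab(2), of m] by (simp add: H_def)
    ultimately have "?e * ?e \<le> (M * (2 * A * \<rho> ^ m)) * (M * \<eta>)"
      using M A rho by (intro mult_mono) auto
    also have "\<dots> = (M * (sqrt \<rho> ^ m * s))\<^sup>2"
    proof -
      have "(sqrt \<rho> ^ m)\<^sup>2 = ((sqrt \<rho>)\<^sup>2) ^ m"
        by (simp only: power_mult[symmetric] mult.commute)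
      then have "(sqrt \<rho> ^ m)\<^sup>2 = \<rho> ^ m" using rho by simp
      then show ?thesis
        by (simp only: power_mult_distrib s(2)) (simp add: power2_eq_square)
    qed
    finally have "?e\<^sup>2 \<le> (M * (sqrt \<rho> ^ m * s))\<^sup>2" by (simp add: power2_eq_square)
    then have "?e \<le> M * (sqrt \<rho> ^ m * s)"
      by (rule power2_le_imp_le) (use M rho s in simp)
    also have "\<dots> \<le> M * (r ^ m * s)"
      using M rho s by (intro mult_left_mono mult_right_mono power_mono) (auto simp: r_def)
    finally have "?e \<le> M * r ^ m * s" by (simp add: mult_ac)
    moreover have "H m a b = ((f.T ^^ m) \<phi> a - (f.T ^^ m) \<phi> b) + H m b b" by (simp add: H_def)
    ultimately have "\<bar>H m a b\<bar> \<le> M * r ^ m * d a b + M * r ^ m * s" using coupling by linarith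
    then show ?thesis by (simp add: distrib_left)
  qed
  have D_bound: "\<bar>D n \<omega>\<bar> \<le> 2 * M * A" if "\<omega> \<in> space P" for n \<omega>
  proof -
    have "\<bar>\<phi> (chain f x U n \<omega>) - cf\<bar> \<le> M * A" "\<bar>\<phi> (chain g x U n \<omega>) - cg\<bar> \<le> M * A"
      using mixing_f[OF in_S(1)[OF that], of 0 n] mixing_g[OF in_S(2)[OF that], of 0 n] by auto
    moreover have "D n \<omega> = (\<phi> (chain f x U n \<omega>) - cf) - (\<phi> (chain g x U n \<omega>) - cg)"
      by (simp add: D_def H_def)
    ultimately show ?thesis by linarith
  qed
  have D_adapted: "adapted n borel (D n)" for n
  proof -
    have "(\<lambda>(a, b). H 0 a b) \<in> borel_measurable (S \<Otimes>\<^sub>M S)"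
      using phi(1) unfolding H_def split_beta' by simp
    from adapted_compose[OF adapted_Pair[OF adapted_chain[OF f x] adapted_chain[OF g x]] this]
    show ?thesis by (simp add: D_def[abs_def])
  qed
  have int_D: "integrable P (\<lambda>\<omega>. D i \<omega> * F \<omega>)"
    if F: "F \<in> borel_measurable P" "\<And>\<omega>. \<omega> \<in> space P \<Longrightarrow> \<bar>F \<omega>\<bar> \<le> b" for i F b
  proof (rule integrable_bounded[where B="2 * M * A * b"])
    fix \<omega> assume "\<omega> \<in> space P"
    then show "\<bar>D i \<omega> * F \<omega>\<bar> \<le> 2 * M * A * b"
      using D_bound[of \<omega> i] F(2)[of \<omega>] M A unfolding abs_mult by (intro mult_mono) auto
  qed (use F D_meas P.finite_measure_axioms in auto)
  have corr: "P.expectation (\<lambda>\<omega>. D i \<omega> * D (i + m) \<omega>) \<le> M\<^sup>2 * (2 * K + 2 * s\<^sup>2) * r ^ m" for i m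
  proof -
    let ?F = "\<lambda>k \<omega>. (f.T ^^ k) \<phi> (chain f x U i \<omega>)" and ?G = "\<lambda>k \<omega>. (g.T ^^ k) \<phi> (chain g x U i \<omega>)"
    let ?F' = "\<lambda>\<omega>. \<phi> (chain f x U (i + m) \<omega>)" and ?G' = "\<lambda>\<omega>. \<phi> (chain g x U (i + m) \<omega>)"
    have int_F: "integrable P (\<lambda>\<omega>. D i \<omega> * ?F m \<omega>)"
      using in_S f.abs_T_pow_le phi by (intro int_D[of _ M]) auto
    have int_G: "integrable P (\<lambda>\<omega>. D i \<omega> * ?G m \<omega>)"
      using in_S g.abs_T_pow_le phi by (intro int_D[of _ M]) auto
    have int_F': "integrable P (\<lambda>\<omega>. D i \<omega> * ?F' \<omega>)"
      using in_S phi measurable_compose[OF chain_f phi(1)] by (intro int_D[of _ M]) auto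
    have int_G': "integrable P (\<lambda>\<omega>. D i \<omega> * ?G' \<omega>)"
      using in_S phi measurable_compose[OF chain_g phi(1)] by (intro int_D[of _ M]) auto
    have int_c: "integrable P (\<lambda>\<omega>. D i \<omega> * (cf - cg))"
      by (rule int_D) auto
    have int_dd: "integrable P (\<lambda>\<omega>. (?d i \<omega>)\<^sup>2)"
    proof (rule integrable_bounded[OF P.finite_measure_axioms])
      show "\<bar>(?d i \<omega>)\<^sup>2\<bar> \<le> B\<^sup>2" if "\<omega> \<in> space P" for \<omega>
        using d_range[OF in_S[OF that]] by (simp add: power_mono)
    qed (use d_meas'[of i] in simp)
    have "P.expectation (\<lambda>\<omega>. D i \<omega> * D (i + m) \<omega>)
        = P.expectation (\<lambda>\<omega>. D i \<omega> * ?F' \<omega> - D i \<omega> * ?G' \<omega> - D i \<omega> * (cf - cg))"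
      by (rule arg_cong[where f="integral\<^sup>L P"]) (simp add: D_def[of "i + m"] H_def fun_eq_iff algebra_simps)
    also have "\<dots> = P.expectation (\<lambda>\<omega>. D i \<omega> * ?F' \<omega>) - P.expectation (\<lambda>\<omega>. D i \<omega> * ?G' \<omega>)
        - P.expectation (\<lambda>\<omega>. D i \<omega> * (cf - cg))"
      using int_F' int_G' int_c by (simp only: Bochner_Integration.integral_diff Bochner_Integration.integrable_diff)
    also have "\<dots> = P.expectation (\<lambda>\<omega>. D i \<omega> * ?F m \<omega>) - P.expectation (\<lambda>\<omega>. D i \<omega> * ?G m \<omega>)
        - P.expectation (\<lambda>\<omega>. D i \<omega> * (cf - cg))"
      using expectation_chain_add[OF f x D_adapted D_bound phi]
        expectation_chain_add[OF g x D_adapted D_bound phi] by simp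
    also have "\<dots> = P.expectation (\<lambda>\<omega>. D i \<omega> * ?F m \<omega> - D i \<omega> * ?G m \<omega> - D i \<omega> * (cf - cg))"
      using int_F int_G int_c by (simp only: Bochner_Integration.integral_diff Bochner_Integration.integrable_diff)
    also have "\<dots> \<le> P.expectation (\<lambda>\<omega>. M\<^sup>2 * r ^ m * (2 * (?d i \<omega>)\<^sup>2 + 2 * s\<^sup>2))"
    proof (rule integral_mono)
      show "integrable P (\<lambda>\<omega>. D i \<omega> * ?F m \<omega> - D i \<omega> * ?G m \<omega> - D i \<omega> * (cf - cg))"
        using int_F int_G int_c by (intro Bochner_Integration.integrable_diff)
      show "integrable P (\<lambda>\<omega>. M\<^sup>2 * r ^ m * (2 * (?d i \<omega>)\<^sup>2 + 2 * s\<^sup>2))"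
        using int_dd by simp
      fix \<omega> assume \<omega>: "\<omega> \<in> space P"
      note Hs = H_le[OF in_S[OF \<omega>], of 0 i i] H_le[OF in_S[OF \<omega>], of m i i]
      have "D i \<omega> * ?F m \<omega> - D i \<omega> * ?G m \<omega> - D i \<omega> * (cf - cg)
          = H 0 (chain f x U i \<omega>) (chain g x U i \<omega>) * H m (chain f x U i \<omega>) (chain g x U i \<omega>)"
        by (simp add: D_def[of i] H_def[of m] algebra_simps)
      also have "\<dots> \<le> \<bar>H 0 (chain f x U i \<omega>) (chain g x U i \<omega>)\<bar> * \<bar>H m (chain f x U i \<omega>) (chain g x U i \<omega>)\<bar>"
        by (metis abs_ge_self abs_mult)
      also have "\<dots> \<le> (M * r ^ 0 * (?d i \<omega> + s)) * (M * r ^ m * (?d i \<omega> + s))"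
        using Hs M s(1) d_range[OF in_S[OF \<omega>]] by (intro mult_mono) auto
      also have "\<dots> = M\<^sup>2 * r ^ m * (?d i \<omega> + s)\<^sup>2" by (simp add: power2_eq_square)
      also have "\<dots> \<le> M\<^sup>2 * r ^ m * (2 * (?d i \<omega>)\<^sup>2 + 2 * s\<^sup>2)"
      proof (rule mult_left_mono)
        have "0 \<le> (?d i \<omega> - s)\<^sup>2" by simp
        then show "(?d i \<omega> + s)\<^sup>2 \<le> 2 * (?d i \<omega>)\<^sup>2 + 2 * s\<^sup>2"
          by (simp add: power2_eq_square algebra_simps)
      qed (use r in simp)
      finally show "D i \<omega> * ?F m \<omega> - D i \<omega> * ?G m \<omega> - D i \<omega> * (cf - cg)
          \<le> M\<^sup>2 * r ^ m * (2 * (?d i \<omega>)\<^sup>2 + 2 * s\<^sup>2)" .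
    qed
    also have "\<dots> = M\<^sup>2 * r ^ m * (2 * P.expectation (\<lambda>\<omega>. (?d i \<omega>)\<^sup>2) + 2 * s\<^sup>2)"
      using int_dd by (simp add: P.prob_space)
    also have "\<dots> \<le> M\<^sup>2 * r ^ m * (2 * K + 2 * s\<^sup>2)"
      using expectation_coupled_distance_le[OF f g x d_meas d_range d_self d_triangle tau contr close]
        r unfolding K_def by (intro mult_left_mono add_right_mono) auto
    finally show ?thesis by (simp add: mult_ac)
  qed
  have "0 \<le> (\<integral>u. (d (f x u) (g x u))\<^sup>2 \<partial>\<mu>)" by (rule integral_nonneg_AE) simp
  then have "0 \<le> c" using close[OF x] by linarith
  then have K: "0 \<le> K" using tau by (simp add: K_def)
  have "P.expectation (\<lambda>\<omega>. (\<Sum>n=1..N. D n \<omega>)\<^sup>2) \<le> real N * (2 * (M\<^sup>2 * (2 * K + 2 * s\<^sup>2)) / (1 - r))"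
    using D_meas D_bound corr r K by (intro P.second_moment_sum_le) auto
  then have "P.expectation (\<lambda>\<omega>. (\<Sum>n=1..N. D n \<omega>)\<^sup>2) / (real N)\<^sup>2
      \<le> real N * (2 * (M\<^sup>2 * (2 * K + 2 * s\<^sup>2)) / (1 - r)) / (real N)\<^sup>2"
    by (rule divide_right_mono) simp
  also have "\<dots> = 2 * (M\<^sup>2 * (2 * K + 2 * s\<^sup>2)) / (1 - r) / real N"
    using N by (simp add: power2_eq_square[of "real N"])
  also have "\<dots> = M\<^sup>2 * (4 * (K + s\<^sup>2) / (1 - r)) / real N"
  proof -
    have "2 * (M\<^sup>2 * (2 * K + 2 * s\<^sup>2)) = M\<^sup>2 * (4 * (K + s\<^sup>2))" by (simp add: distrib_left)
    then show ?thesis by simp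
  qed
  finally have "P.expectation (\<lambda>\<omega>. (\<Sum>n=1..N. D n \<omega>)\<^sup>2) / (real N)\<^sup>2
      \<le> M\<^sup>2 * (4 * (K + s\<^sup>2) / (1 - r)) / real N" .
  moreover have "(\<lambda>\<omega>. (1 / real N *
        (\<Sum>n=1..N. (\<phi> (chain f x U n \<omega>) - \<phi> (chain g x U n \<omega>)) - (cf - cg)))\<^sup>2)
      = (\<lambda>\<omega>. (\<Sum>n=1..N. D n \<omega>)\<^sup>2 / (real N)\<^sup>2)"
  proof
    fix \<omega>
    have "(\<Sum>n=1..N. (\<phi> (chain f x U n \<omega>) - \<phi> (chain g x U n \<omega>)) - (cf - cg)) = (\<Sum>n=1..N. D n \<omega>)"
      by (intro sum.cong) (auto simp: D_def H_def)
    then show "(1 / real N *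
        (\<Sum>n=1..N. (\<phi> (chain f x U n \<omega>) - \<phi> (chain g x U n \<omega>)) - (cf - cg)))\<^sup>2
      = (\<Sum>n=1..N. D n \<omega>)\<^sup>2 / (real N)\<^sup>2"
      by (simp add: power_divide)
  qed
  ultimately show ?thesis
    by (simp add: K_def s(2) r_def)
qed

section \<open>Norms and kernels on the state space\<close>

lemma l1_norm_nonneg: "0 \<le> l1_norm x"
  by (simp add: l1_norm_def sum_nonneg)

lemma l1_norm_triangle: "l1_norm (x - z) \<le> l1_norm (x - y) + l1_norm (y - z)"
  unfolding l1_norm_def sum.distrib[symmetric]
  by (intro sum_mono) (simp add: inner_diff_left)

lemma l1_norm_pos: "x \<noteq> 0 \<Longrightarrow> 0 < l1_norm x"
  using euclidean_all_zero_iff[of x] l1_norm_nonneg[of x]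
  by (auto simp: l1_norm_def sum_nonneg_eq_0_iff less_le)

lemma l1_norm_le: "l1_norm (x :: 'a::euclidean_space) \<le> DIM('a) * norm x"
  unfolding l1_norm_def by (rule sum_bounded_above) (rule Basis_le_norm)

lemma bounded_l1_distance:
  fixes X :: "'a::euclidean_space set"
  assumes "bounded X"
  obtains D where "\<And>x y. x \<in> X \<Longrightarrow> y \<in> X \<Longrightarrow> l1_norm (x - y) \<le> D"
proof -
  obtain e where e: "\<And>x y. x \<in> X \<Longrightarrow> y \<in> X \<Longrightarrow> dist x y \<le> e"
    using assms unfolding bounded_two_points by blast
  show ?thesis
  proof (rule that)
    fix x y assume "x \<in> X" "y \<in> X"
    then have "norm (x - y) \<le> e" using e by (simp add: dist_norm)
    then have "DIM('a) * norm (x - y) \<le> DIM('a) * e" by (intro mult_left_mono) auto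
    then show "l1_norm (x - y) \<le> DIM('a) * e" using l1_norm_le[of "x - y"] by linarith
  qed
qed

lemma measurable_l1_distance:
  "(\<lambda>(x, y). l1_norm (x - y :: 'a::euclidean_space))
    \<in> borel_measurable (restrict_space borel X \<Otimes>\<^sub>M restrict_space borel X)"
proof -
  have [measurable]: "fst \<in> restrict_space borel X \<Otimes>\<^sub>M restrict_space borel X \<rightarrow>\<^sub>M (borel :: 'a measure)"
    "snd \<in> restrict_space borel X \<Otimes>\<^sub>M restrict_space borel X \<rightarrow>\<^sub>M (borel :: 'a measure)"
    using measurable_fst[of "restrict_space borel X" "restrict_space borel X"]
      measurable_snd[of "restrict_space borel X" "restrict_space borel X"]
    by (simp_all add: measurable_restrict_space2_iff)
  show ?thesis unfolding l1_norm_def split_beta' by measurable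
qed

lemma abs_le_sup_norm_on:
  assumes "\<phi> \<in> bounded_measurable_on X" "x \<in> X"
  shows "\<bar>\<phi> x\<bar> \<le> sup_norm_on X \<phi>"
proof -
  obtain b where "\<forall>y\<in>X. \<bar>\<phi> y\<bar> \<le> b"
    using assms(1) by (auto simp: bounded_measurable_on_def bounded_iff)
  then have "bdd_above ((\<lambda>x. \<bar>\<phi> x\<bar>) ` X)" by (auto intro!: bdd_aboveI2)
  then show ?thesis unfolding sup_norm_on_def using assms(2) by (rule cSUP_upper2) simp
qed

lemma abs_diff_le_Lip_seminorm_on:
  assumes "\<phi> \<in> l1_Lipschitz_on X" "x \<in> X" "y \<in> X"
  shows "\<bar>\<phi> x - \<phi> y\<bar> \<le> Lip_seminorm_on X \<phi> * l1_norm (x - y)"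
proof (cases "x = y")
  case False
  let ?Q = "{\<bar>\<phi> x - \<phi> y\<bar> / l1_norm (x - y) | x y. x \<in> X \<and> y \<in> X \<and> x \<noteq> y}"
  obtain L where L: "\<forall>x\<in>X. \<forall>y\<in>X. \<bar>\<phi> x - \<phi> y\<bar> \<le> L * l1_norm (x - y)"
    using assms(1) by (auto simp: l1_Lipschitz_on_def)
  have "q \<le> max 0 L" if "q \<in> insert 0 ?Q" for q
  proof (cases "q = 0")
    case False
    with that obtain x y where "q = \<bar>\<phi> x - \<phi> y\<bar> / l1_norm (x - y)" "x \<in> X" "y \<in> X" "x \<noteq> y"
      by blast
    then have "q \<le> L" using L l1_norm_pos[of "x - y"] by (simp add: pos_divide_le_eq)
    then show ?thesis by simp
  qed simp
  then have "bdd_above (insert 0 ?Q)" by (rule bdd_aboveI)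
  moreover have "\<bar>\<phi> x - \<phi> y\<bar> / l1_norm (x - y) \<in> insert 0 ?Q" using assms False by blast
  ultimately have "\<bar>\<phi> x - \<phi> y\<bar> / l1_norm (x - y) \<le> Lip_seminorm_on X \<phi>"
    unfolding Lip_seminorm_on_def by (rule cSup_upper[rotated])
  then show ?thesis using l1_norm_pos[of "x - y"] False by (simp add: pos_divide_le_eq)
qed (simp add: l1_norm_def)

lemma max_norm_on_bounds:
  assumes "\<phi> \<in> bounded_measurable_on X \<inter> l1_Lipschitz_on X" "x \<in> X"
  shows "\<bar>\<phi> x\<bar> \<le> max_norm_on X \<phi>"
    and "y \<in> X \<Longrightarrow> \<bar>\<phi> x - \<phi> y\<bar> \<le> max_norm_on X \<phi> * l1_norm (x - y)"
proof -
  show "\<bar>\<phi> x\<bar> \<le> max_norm_on X \<phi>"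
    using abs_le_sup_norm_on[of \<phi> X x] assms by (auto simp: max_norm_on_def)
  assume "y \<in> X"
  have "Lip_seminorm_on X \<phi> * l1_norm (x - y) \<le> max_norm_on X \<phi> * l1_norm (x - y)"
    by (intro mult_right_mono l1_norm_nonneg) (simp add: max_norm_on_def)
  then show "\<bar>\<phi> x - \<phi> y\<bar> \<le> max_norm_on X \<phi> * l1_norm (x - y)"
    using abs_diff_le_Lip_seminorm_on[of \<phi> X x y] assms \<open>y \<in> X\<close> by auto
qed

lemma bounded_measurable_onI:
  assumes "\<phi> \<in> borel_measurable (restrict_space borel X)" "\<And>x. x \<in> X \<Longrightarrow> \<bar>\<phi> x\<bar> \<le> b"
  shows "\<phi> \<in> bounded_measurable_on X"
  using assms by (auto simp: bounded_measurable_on_def bounded_iff)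

text \<open>
  The factor \<open>max 1 C\<close> covers \<open>n = 0\<close>, where the difference is only known to be at most
  \<open>2 * B\<close>.
\<close>

lemma markov_op_pow_mixing:
  assumes rm: "random_map (restrict_space borel X) \<mu> \<xi>"
    and \<pi>: "prob_space \<pi>" "sets \<pi> = sets (restrict_space borel X)"
    and tv: "\<And>n x. 1 \<le> n \<Longrightarrow> x \<in> X \<Longrightarrow>
        tv_dist (kernel_iter X (map_kernel X \<mu> \<xi>) n x) \<pi> \<le> C * \<rho> ^ n"
    and rho: "0 < \<rho>"
    and phi: "\<phi> \<in> borel_measurable (restrict_space borel X)" "\<And>y. y \<in> X \<Longrightarrow> \<bar>\<phi> y\<bar> \<le> B"
    and x: "x \<in> X"
  shows "\<bar>(markov_op \<mu> \<xi> ^^ n) \<phi> x - (\<integral>y. \<phi> y \<partial>\<pi>)\<bar> \<le> B * (2 * max 1 C) * \<rho> ^ n"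
proof -
  have B: "0 \<le> B" using phi(2)[OF x] by linarith
  have space: "space M = X" if "sets M = sets (restrict_space borel X)" for M :: "'a measure"
    using sets_eq_imp_space_eq[OF that] by (simp add: space_restrict_space)
  have meas: "\<phi> \<in> borel_measurable M" if "sets M = sets (restrict_space borel X)" for M :: "'a measure"
    using phi(1) measurable_cong_sets[OF that refl] by auto
  show ?thesis
  proof (cases "n = 0")
    case True
    have "\<bar>\<integral>y. \<phi> y \<partial>\<pi>\<bar> \<le> B"
      using phi(2) space[OF \<pi>(2)] by (intro abs_integral_le_bound \<pi> meas) auto
    then have "\<bar>\<phi> x - (\<integral>y. \<phi> y \<partial>\<pi>)\<bar> \<le> B * (2 * 1)" using phi(2)[OF x] by linarith
    also have "\<dots> \<le> B * (2 * max 1 C)" using B by (intro mult_left_mono) auto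
    finally show ?thesis using True by simp
  next
    case False
    let ?\<kappa> = "kernel_iter X (map_kernel X \<mu> \<xi>) n x"
    note \<kappa> = prob_space_kernel_iter[OF rm x, of n] sets_kernel_iter[OF rm x, of n]
    have "\<bar>(\<integral>y. \<phi> y \<partial>?\<kappa>) - (\<integral>y. \<phi> y \<partial>\<pi>)\<bar> \<le> 2 * B * tv_dist ?\<kappa> \<pi>"
      using phi(2) space[OF \<kappa>(2)] \<kappa>(2) \<pi>(2)
      by (intro abs_integral_diff_le_tv_dist \<kappa>(1) \<pi>(1) meas) auto
    also have "\<dots> \<le> 2 * B * (max 1 C * \<rho> ^ n)"
    proof (rule mult_left_mono)
      have "tv_dist ?\<kappa> \<pi> \<le> C * \<rho> ^ n" using False x by (intro tv) auto
      also have "\<dots> \<le> max 1 C * \<rho> ^ n" using rho by (intro mult_right_mono) auto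
      finally show "tv_dist ?\<kappa> \<pi> \<le> max 1 C * \<rho> ^ n" .
    qed (use B in simp)
    finally show ?thesis
      using integral_kernel_iter[OF rm x phi] by (simp add: mult_ac)
  qed
qed

section \<open>The bound for the coupled chains of consecutive levels\<close>

theorem theorem3p1:
  fixes X :: "'a::euclidean_space set"
    and h :: "nat \<Rightarrow> real" and \<beta> :: real
    and \<pi> :: "nat \<Rightarrow> 'a measure" and \<pi>_lim :: "'a measure"
    and \<mu> :: "'u measure"
    and \<xi> :: "nat \<Rightarrow> 'a \<Rightarrow> 'u \<Rightarrow> 'a"
    and K :: "nat \<Rightarrow> 'a \<Rightarrow> 'a measure"
    and P :: "'w measure"
    and U :: "nat \<Rightarrow> nat \<Rightarrow> 'w \<Rightarrow> 'u"
    and X0 :: "nat \<Rightarrow> 'a"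
  assumes X_compact: "compact X"
    and h_lt_1: "h 0 < 1"
    and h_decreasing: "\<And>l. h (Suc l) < h l"
    and h_pos: "\<And>l. 0 < h l"
    and beta_pos: "0 < \<beta>"
    and pi_prob: "\<And>l. prob_space (\<pi> l)"
    and pi_sets: "\<And>l. sets (\<pi> l) = sets (restrict_space borel X)"
    and pi_lim_prob: "prob_space \<pi>_lim"
    and pi_lim_sets: "sets \<pi>_lim = sets (restrict_space borel X)"
    and pi_conv: "\<And>\<phi>. \<phi> \<in> bounded_measurable_on X \<Longrightarrow>
        (\<lambda>l. \<bar>(\<integral>x. \<phi> x \<partial>\<pi> l) - (\<integral>x. \<phi> x \<partial>\<pi>_lim)\<bar>) \<longlonglongrightarrow> 0"
    and mu_prob: "prob_space \<mu>"
    and xi_measurable: "\<And>l. (\<lambda>(x, u). \<xi> l x u)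
        \<in> restrict_space borel X \<Otimes>\<^sub>M \<mu> \<rightarrow>\<^sub>M restrict_space borel X"
    and K_def: "\<And>l. K l = map_kernel X \<mu> (\<xi> l)"
    and invariant: "\<And>l. invariant_measure (K l) (\<pi> l)"
    and X0_in: "\<And>l. l \<ge> 1 \<Longrightarrow> X0 l \<in> X"
    and P_prob: "prob_space P"
    and U_indep: "\<And>l. l \<ge> 1 \<Longrightarrow> prob_space.indep_vars P (\<lambda>_. \<mu>) (U l) {1..}"
    and U_law: "\<And>l n. l \<ge> 1 \<Longrightarrow> n \<ge> 1 \<Longrightarrow> distr P \<mu> (U l n) = \<mu>"
    and A1: "\<exists>C1 \<rho>. 0 < \<rho> \<and> \<rho> < 1 \<and>
        (\<forall>n\<ge>1. \<forall>l. \<forall>x\<in>X. tv_dist (kernel_iter X (K l) n x) (\<pi> l) \<le> C1 * \<rho> ^ n)"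
    and A2: "\<exists>C2. \<forall>l\<ge>1. \<forall>\<phi>\<in>bounded_measurable_on X \<inter> l1_Lipschitz_on X. \<forall>x\<in>X. \<forall>y\<in>X.
        \<bar>kernel_apply (K l) \<phi> x - kernel_apply (K l) \<phi> y\<bar>
          \<le> C2 * max_norm_on X \<phi> * l1_norm (x - y)"
    and A3: "\<exists>C3. \<forall>l\<ge>1. \<forall>\<phi>\<in>bounded_measurable_on X.
        \<bar>(\<integral>x. \<phi> x \<partial>\<pi> l) - (\<integral>x. \<phi> x \<partial>\<pi> (l - 1))\<bar> \<le> C3 * sup_norm_on X \<phi> * h l powr \<beta> \<and>
        (\<forall>x\<in>X. \<bar>kernel_apply (K l) \<phi> x - kernel_apply (K (l - 1)) \<phi> x\<bar>
          \<le> C3 * sup_norm_on X \<phi> * h l powr \<beta>)"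
    and A4: "\<exists>\<tau>. 0 < \<tau> \<and> \<tau> < 1 \<and> (\<forall>l\<ge>1. \<forall>x\<in>X. \<forall>y\<in>X.
        (\<integral>u. (l1_norm (\<xi> l x u - \<xi> l y u))\<^sup>2 \<partial>\<mu>) \<le> \<tau> * (l1_norm (x - y))\<^sup>2)"
    and A5: "\<exists>C5. \<forall>l\<ge>1. \<forall>x\<in>X.
        (\<integral>u. (l1_norm (\<xi> l x u - \<xi> (l - 1) x u))\<^sup>2 \<partial>\<mu>) \<le> C5 * h l powr \<beta>"
  shows "\<exists>C. \<forall>l\<ge>1. \<forall>N\<ge>1. \<forall>\<phi>\<in>bounded_measurable_on X \<inter> l1_Lipschitz_on X.
      prob_space.expectation P (\<lambda>\<omega>.
        (1 / real N * (\<Sum>n=1..N.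
          (\<phi> (chain (\<xi> l) (X0 l) (U l) n \<omega>) - \<phi> (chain (\<xi> (l - 1)) (X0 l) (U l) n \<omega>))
          - ((\<integral>x. \<phi> x \<partial>\<pi> l) - (\<integral>x. \<phi> x \<partial>\<pi> (l - 1)))))\<^sup>2)
      \<le> C * (max_norm_on X \<phi>)\<^sup>2 * h l powr \<beta> / real N"
proof -
  let ?S = "restrict_space borel X" and ?d = "\<lambda>x y. l1_norm (x - y :: 'a)"
  obtain C1 \<rho> where rho: "0 < \<rho>" "\<rho> < 1"
    and C1: "\<And>n l x. 1 \<le> n \<Longrightarrow> x \<in> X \<Longrightarrow> tv_dist (kernel_iter X (K l) n x) (\<pi> l) \<le> C1 * \<rho> ^ n"
    using A1 by blast
  obtain C3 where C3: "\<And>l \<phi>. 1 \<le> l \<Longrightarrow> \<phi> \<in> bounded_measurable_on X \<Longrightarrow>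
      \<bar>(\<integral>x. \<phi> x \<partial>\<pi> l) - (\<integral>x. \<phi> x \<partial>\<pi> (l - 1))\<bar> \<le> C3 * sup_norm_on X \<phi> * h l powr \<beta>"
    "\<And>l \<phi> x. 1 \<le> l \<Longrightarrow> \<phi> \<in> bounded_measurable_on X \<Longrightarrow> x \<in> X \<Longrightarrow>
      \<bar>kernel_apply (K l) \<phi> x - kernel_apply (K (l - 1)) \<phi> x\<bar> \<le> C3 * sup_norm_on X \<phi> * h l powr \<beta>"
    using A3 by blast
  obtain \<tau> where tau: "0 < \<tau>" "\<tau> < 1" and contr: "\<And>l x y. 1 \<le> l \<Longrightarrow> x \<in> X \<Longrightarrow> y \<in> X \<Longrightarrow>
      (\<integral>u. (l1_norm (\<xi> l x u - \<xi> l y u))\<^sup>2 \<partial>\<mu>) \<le> \<tau> * (l1_norm (x - y))\<^sup>2"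
    using A4 by blast
  obtain C5 where C5: "\<And>l x. 1 \<le> l \<Longrightarrow> x \<in> X \<Longrightarrow>
      (\<integral>u. (l1_norm (\<xi> l x u - \<xi> (l - 1) x u))\<^sup>2 \<partial>\<mu>) \<le> C5 * h l powr \<beta>"
    using A5 by blast
  obtain D where D: "\<And>x y. x \<in> X \<Longrightarrow> y \<in> X \<Longrightarrow> l1_norm (x - y) \<le> D"
    using bounded_l1_distance[OF compact_imp_bounded[OF X_compact]] by blast
  define A where "A = 2 * max 1 C1"
  \<comment> \<open>\<open>C3\<close> may be negative, in which case it cannot be combined with an upper bound on the
    supremum norm.\<close>
  define C3' where "C3' = max 0 C3"
  \<comment> \<open>The two summands account for the iterated kernels and for the invariant measures.\<close>
  define B where "B = (A / (1 - \<rho>) + 1) * C3'"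
  define C where "C = 4 * (2 * (1 + \<tau>) / (1 - \<tau>)\<^sup>2 * C5 + 2 * A * B) / (1 - max (sqrt \<tau>) (sqrt \<rho>))"
  have A: "0 \<le> A" by (simp add: A_def)
  have C3': "0 \<le> C3'" "C3 \<le> C3'" by (auto simp: C3'_def)
  have B: "0 \<le> B" using A C3' rho by (simp add: B_def)
  have space_S: "space ?S = X" by (simp add: space_restrict_space)
  have rm: "random_map ?S \<mu> (\<xi> l)" for l
    by (rule random_map.intro[OF mu_prob xi_measurable])
  have sup_le: "C3 * sup_norm_on X \<psi> * e \<le> C3' * b * e"
    if "\<psi> \<in> bounded_measurable_on X" "\<And>x. x \<in> X \<Longrightarrow> \<bar>\<psi> x\<bar> \<le> b" "x \<in> X" "0 \<le> e" for \<psi> b x e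
  proof -
    have "0 \<le> sup_norm_on X \<psi>" using abs_le_sup_norm_on[OF that(1,3)] by linarith
    moreover have "sup_norm_on X \<psi> \<le> b"
      unfolding sup_norm_on_def using that by (intro cSUP_least) auto
    ultimately show ?thesis using C3' that(4) by (intro mult_right_mono mult_mono) auto
  qed
  have "prob_space.expectation P (\<lambda>\<omega>. (1 / real N * (\<Sum>n=1..N.
          (\<phi> (chain (\<xi> l) (X0 l) (U l) n \<omega>) - \<phi> (chain (\<xi> (l - 1)) (X0 l) (U l) n \<omega>))
          - ((\<integral>x. \<phi> x \<partial>\<pi> l) - (\<integral>x. \<phi> x \<partial>\<pi> (l - 1)))))\<^sup>2)
      \<le> C * (max_norm_on X \<phi>)\<^sup>2 * h l powr \<beta> / real N"
    if l: "1 \<le> l" and N: "1 \<le> N" and phi: "\<phi> \<in> bounded_measurable_on X \<inter> l1_Lipschitz_on X" for l N \<phi>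
  proof -
    interpret iid_innovations P \<mu> "U l"
      using P_prob U_indep U_law l by (intro iid_innovations.intro) auto
    define M where "M = max_norm_on X \<phi>"
    define e where "e = h l powr \<beta>"
    have x: "X0 l \<in> X" by (rule X0_in[OF l])
    have e: "0 \<le> e" by (simp add: e_def)
    have phi_meas: "\<phi> \<in> borel_measurable ?S" using phi by (simp add: bounded_measurable_on_def)
    have phi_bound: "\<bar>\<phi> y\<bar> \<le> M" if "y \<in> X" for y
      using max_norm_on_bounds(1)[OF phi that] by (simp add: M_def)
    have M: "0 \<le> M" using phi_bound[OF x] by linarith
    have mixing: "\<bar>(markov_op \<mu> (\<xi> k) ^^ n) \<phi> y - (\<integral>x. \<phi> x \<partial>\<pi> k)\<bar> \<le> M * A * \<rho> ^ n"
      if "y \<in> X" for k n y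
      unfolding A_def
      using markov_op_pow_mixing[OF rm pi_prob pi_sets _ rho(1) phi_meas phi_bound that] C1 K_def
      by simp
    have kernel_near: "\<bar>markov_op \<mu> (\<xi> l) \<psi> y - markov_op \<mu> (\<xi> (l - 1)) \<psi> y\<bar> \<le> b * (C3' * e)"
      if psi: "\<psi> \<in> borel_measurable ?S" "\<And>y. y \<in> space ?S \<Longrightarrow> \<bar>\<psi> y\<bar> \<le> b" and y: "y \<in> space ?S"
      for \<psi> b y
    proof -
      have y': "y \<in> X" and b: "\<And>y. y \<in> X \<Longrightarrow> \<bar>\<psi> y\<bar> \<le> b" using y psi(2) space_S by auto
      have bm: "\<psi> \<in> bounded_measurable_on X" by (rule bounded_measurable_onI[OF psi(1) b])
      have "\<bar>kernel_apply (K l) \<psi> y - kernel_apply (K (l - 1)) \<psi> y\<bar> \<le> C3' * b * e"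
        using C3(2)[OF l bm y'] sup_le[OF bm b y' e] by (simp add: e_def)
      then show ?thesis
        using kernel_apply_map_kernel[OF rm psi(1) y'] by (simp add: K_def mult_ac)
    qed
    have near: "\<bar>(markov_op \<mu> (\<xi> l) ^^ n) \<phi> y - (\<integral>x. \<phi> x \<partial>\<pi> l)
        - ((markov_op \<mu> (\<xi> (l - 1)) ^^ n) \<phi> y - (\<integral>x. \<phi> x \<partial>\<pi> (l - 1)))\<bar> \<le> M * (B * e)"
      if y: "y \<in> X" for n y
    proof -
      have "\<bar>(markov_op \<mu> (\<xi> l) ^^ n) \<phi> y - (markov_op \<mu> (\<xi> (l - 1)) ^^ n) \<phi> y\<bar>
          \<le> M * A * (C3' * e) / (1 - \<rho>)"
        by (rule markov_op_pow_diff_le[OF rm rm phi_meas, where B=M and c="\<integral>x. \<phi> x \<partial>\<pi> (l - 1)"])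
          (use phi_bound mixing kernel_near rho M A C3' e y space_S in auto)
      moreover have "\<bar>(\<integral>x. \<phi> x \<partial>\<pi> l) - (\<integral>x. \<phi> x \<partial>\<pi> (l - 1))\<bar> \<le> C3' * M * e"
        using C3(1)[OF l, of \<phi>] sup_le[of \<phi> M, OF _ phi_bound x e] phi by (simp add: e_def)
      moreover have "M * (B * e) = M * A * (C3' * e) / (1 - \<rho>) + C3' * M * e"
        by (simp add: B_def distrib_left distrib_right mult_ac)
      ultimately show ?thesis by linarith
    qed
    have "prob_space.expectation P (\<lambda>\<omega>. (1 / real N * (\<Sum>n=1..N.
          (\<phi> (chain (\<xi> l) (X0 l) (U l) n \<omega>) - \<phi> (chain (\<xi> (l - 1)) (X0 l) (U l) n \<omega>))
          - ((\<integral>x. \<phi> x \<partial>\<pi> l) - (\<integral>x. \<phi> x \<partial>\<pi> (l - 1)))))\<^sup>2)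
      \<le> M\<^sup>2 * (4 * (2 * (1 + \<tau>) / (1 - \<tau>)\<^sup>2 * (C5 * e) + 2 * A * (B * e))
          / (1 - max (sqrt \<tau>) (sqrt \<rho>))) / real N"
    proof (rule expectation_coupled_average_le[OF rm rm _ measurable_l1_distance, where B=D])
      show "0 \<le> l1_norm (x - y) \<and> l1_norm (x - y) \<le> D" if "x \<in> space ?S" "y \<in> space ?S" for x y
        using D l1_norm_nonneg that space_S by simp
      show "l1_norm (x - x) = 0" for x :: 'a by (simp add: l1_norm_def)
      show "l1_norm (x - z) \<le> l1_norm (x - y) + l1_norm (y - z)" for x y z :: 'a
        by (rule l1_norm_triangle)
      show "\<bar>\<phi> x - \<phi> y\<bar> \<le> M * l1_norm (x - y)" if "x \<in> space ?S" "y \<in> space ?S" for x y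
        using max_norm_on_bounds(2)[OF phi] that space_S by (simp add: M_def)
    qed (use x tau rho contr[OF l] C5[OF l] phi_meas phi_bound mixing near A B e N space_S e_def in auto)
    also have "\<dots> = C * M\<^sup>2 * e / real N"
      by (simp add: C_def distrib_left distrib_right mult_ac)
    finally show ?thesis by (simp add: M_def e_def)
  qed
  then show ?thesis by blast
qed

end
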